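(* Consider the interconnected system $\Sigma:\dot x=f(x,u)$ of subsystems $\Sigma_i:\dot x_i=f_i(x_1,\dots,x_n,u)$, $i=1,\dots,n$, where each $\Sigma_i$ has an ISS Lyapunov function $V_i$ with gains $\gamma_{ij}\in\mathcal K_\infty\cup\{0\}$, $\gamma_{iu}\in\mathcal K\cup\{0\}$ and monotone aggregation function $\mu_i\in\mathrm{MAF}_{n+1}$, and let $\Gamma_\mu$, $\overline\Gamma_\mu$ be the corresponding gain operators. Assume there are an $\Omega$-path $\sigma$ with respect to $\Gamma_\mu$ and a function $\varphi\in\mathcal K_\infty$ such that $$\overline\Gamma_\mu(\sigma(r),\varphi(r))<\sigma(r)\qquad\text{for all } r>0.$$ Then an ISS Lyapunov function for the overall system $\Sigma$ is given by $$V(x)=\max_{i=1,\dots,n}\sigma_i^{-1}(V_i(x_i)).$$ In particular, for all points of differentiability of $V$ we have the implication $$V(x)\ge\max\{\varphi^{-1}(\gamma_{iu}(\|u\|))\;|\;i=1,\dots,n\}\quad\Longrightarrow\quad\nabla V(x)f(x,u)\le-\alpha(\|x\|),$$ where $\alpha$ is a suitable positive definite function.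
   Context: Notation: $\mathbb R_+=[0,\infty)$; for $v,w\in\mathbb R^n$, $v\ge w$ (resp. $v>w$) means $v_i\ge w_i$ (resp. $v_i>w_i$) for all $i$. $\mathcal K$: continuous strictly increasing $\gamma:\mathbb R_+\to\mathbb R_+$ with $\gamma(0)=0$; $\mathcal K_\infty$: unbounded elements of $\mathcal K$. $\alpha:\mathbb R_+\to\mathbb R_+$ is positive definite if it is continuous and $\alpha(r)=0$ iff $r=0$. System: $x=(x_1^T,\dots,x_n^T)^T$, $x_i\in\mathbb R^{N_i}$, $N=\sum_iN_i$, $u\in\mathbb R^M$, $f_i:\mathbb R^{N+M}\to\mathbb R^{N_i}$, $f=(f_1^T,\dots,f_n^T)^T$. Each $\Sigma_i$, with $x_j$ ($j\ne i$) and $u$ regarded as unrestricted $L^\infty$ inputs, is assumed to have for every initial condition a unique solution defined on $[0,\infty)$. Lyapunov function candidates are functions $V:\mathbb R^N\to\mathbb R_+$ that are continuous, proper and positive definite (there are $\psi_1,\psi_2\in\mathcal K_\infty$ with $\psi_1(\|x\|)\le V(x)\le\psi_2(\|x\|)$ for all $x$) and locally Lipschitz continuous on $\mathbb R^N\setminus\{0\}$. Such a $V$ is an ISS Lyapunov function for $\dot x=f(x,u)$ if there are $\gamma\in\mathcal K$ and a positive definite $\alpha$ such that at all points of differentiability of $V$: $V(x)\ge\gamma(\|u\|)\Rightarrow\nabla V(x)f(x,u)\le-\alpha(\|x\|)$. $\mathrm{MAF}_m$: continuous $\mu:\mathbb R^m_+\to\mathbb R_+$ with (M1) $\mu(s)\ge0$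 for all $s$, and $\mu(s)>0$ if $s\ge0$, $s\ne0$; (M2) $x<y\Rightarrow\mu(x)<\mu(y)$; (M3) $\mu(x)\to\infty$ as $\|x\|\to\infty$. Given Lyapunov function candidates $V_j:\mathbb R^{N_j}\to\mathbb R_+$, $V_i$ is an ISS Lyapunov function for $\Sigma_i$ with $\mu_i\in\mathrm{MAF}_{n+1}$, $\gamma_{ij}\in\mathcal K_\infty\cup\{0\}$ ($\gamma_{ii}\equiv0$), $\gamma_{iu}\in\mathcal K\cup\{0\}$ if there is a positive definite $\alpha_i$ such that at all points of differentiability of $V_i$: $$V_i(x_i)\ge\mu_i(\gamma_{i1}(V_1(x_1)),\dots,\gamma_{in}(V_n(x_n)),\gamma_{iu}(\|u\|))\Rightarrow\nabla V_i(x_i)f_i(x,u)\le-\alpha_i(\|x_i\|).$$ Gain operators: $\overline\Gamma_\mu:\mathbb R^{n+1}_+\to\mathbb R^n_+$, $\overline\Gamma_\mu(s,r)_i=\mu_i(\gamma_{i1}(s_1),\dots,\gamma_{in}(s_n),\gamma_{iu}(r))$, and $\Gamma_\mu(s)=\overline\Gamma_\mu(s,0)$. Standing compatibility assumption: $s\mapsto\mu_i(s,0)$ satisfies (M2), and so does its restriction to the arguments $j$ with $\gamma_{ij}\not\equiv0$ (others set to $0$), whenever there are such $j$. An $\Omega$-path with respect to an operator $T:\mathbb R^n_+\to\mathbb R^n_+$ is a continuous $\sigma=(\sigma_1,\dots,\sigma_n)\in\mathcal K_\infty^n$ such that (i) each $\sigma_i^{-1}$ is locally Lipschitz continuous on $(0,\infty)$;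 (ii) for every compact $K\subset(0,\infty)$ there are $0<c<C$ with $c\le(\sigma_i^{-1})'(r)\le C$ for all $i$ and all points $r\in K$ of differentiability of $\sigma_i^{-1}$; (iii) $T(\sigma(r))<\sigma(r)$ for all $r>0$.
   Formalization: f(x,u) is assumed continuous in x. As stated the final implication fails: under the given hypothesis it is proved with threshold φ^{-1}(‖u‖); the threshold max φ^{-1}(γ_iu(‖u‖)) is proved when φ(r) itself replaces γ_iu(φ(r)) in the hypothesis. V is an ISS Lyapunov function in both cases. *)

theory Defs
  imports "HOL-Analysis.Analysis"
begin

section \<open>Comparison functions\<close>

text \<open>
  Functions on the half line are functions on \<^typ>\<open>real\<close> of which only the values on
  \<open>{0..}\<close> matter; all conditions are relativised accordingly. Continuity and monotonicity
  together with \<open>\<gamma> 0 = 0\<close> give nonnegative values on \<open>{0..}\<close>.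
\<close>

definition class_K :: "(real \<Rightarrow> real) \<Rightarrow> bool" where
  "class_K \<gamma> \<longleftrightarrow> continuous_on {0..} \<gamma> \<and> strict_mono_on {0..} \<gamma> \<and> \<gamma> 0 = 0"

definition class_Kinf :: "(real \<Rightarrow> real) \<Rightarrow> bool" where
  "class_Kinf \<gamma> \<longleftrightarrow> class_K \<gamma> \<and> \<not> bounded (\<gamma> ` {0..})"

definition zero_gain :: "(real \<Rightarrow> real) \<Rightarrow> bool" where
  "zero_gain \<gamma> \<longleftrightarrow> (\<forall>r\<ge>0. \<gamma> r = 0)"

definition pos_def_fun :: "(real \<Rightarrow> real) \<Rightarrow> bool" where
  "pos_def_fun \<alpha> \<longleftrightarrow> continuous_on {0..} \<alpha> \<and> (\<forall>r\<ge>0. 0 \<le> \<alpha> r \<and> (\<alpha> r = 0 \<longleftrightarrow> r = 0))"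

text \<open>A function of class \<open>\<K>\<^sub>\<infinity>\<close> is a bijection of \<open>{0..}\<close>, and this is its inverse.\<close>

definition Kinv :: "(real \<Rightarrow> real) \<Rightarrow> real \<Rightarrow> real" where
  "Kinv \<gamma> = inv_into {0..} \<gamma>"

text \<open>
  The library notion \<^const>\<open>local_lipschitz\<close> is for families depending on a parameter;
  here the parameter set is a singleton.
\<close>

definition locally_lipschitz_on :: "'a::metric_space set \<Rightarrow> ('a \<Rightarrow> 'b::metric_space) \<Rightarrow> bool" where
  "locally_lipschitz_on X g \<longleftrightarrow> local_lipschitz {0::real} X (\<lambda>_. g)"


section \<open>Monotone aggregation functions and gain operators\<close>

definition orthant :: "(real ^ 'm::finite) set" where
  "orthant = {s. \<forall>i. 0 \<le> s $ i}"

text \<open>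
  The strict order on vectors is componentwise strict; this is not the relation \<open><\<close> that
  the library puts on \<open>real ^ 'm\<close>.
\<close>

definition vless :: "real ^ 'm::finite \<Rightarrow> real ^ 'm \<Rightarrow> bool" where
  "vless v w \<longleftrightarrow> (\<forall>i. v $ i < w $ i)"

definition MAF :: "(real ^ 'm::finite \<Rightarrow> real) \<Rightarrow> bool" where
  "MAF \<mu> \<longleftrightarrow>
     continuous_on orthant \<mu> \<and>
     (\<forall>s\<in>orthant. 0 \<le> \<mu> s \<and> (s \<noteq> 0 \<longrightarrow> 0 < \<mu> s)) \<and>
     (\<forall>s\<in>orthant. \<forall>t\<in>orthant. vless s t \<longrightarrow> \<mu> s < \<mu> t) \<and>
     filterlim \<mu> at_top (inf at_infinity (principal orthant))"

text \<open>
  The subsystems are indexed by the finite type \<open>'n\<close>, so that \<open>n = CARD('n)\<close>. Vectors with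
  \<open>n + 1\<close> entries are indexed by \<open>'n option\<close>: the entry at \<open>Some j\<close> belongs to subsystem \<open>j\<close>,
  the entry at \<open>None\<close> to the external input.
\<close>

definition vjoin :: "real ^ 'n::finite \<Rightarrow> real \<Rightarrow> real ^ 'n option" where
  "vjoin s r = (\<chi> k. case k of None \<Rightarrow> r | Some j \<Rightarrow> s $ j)"

text \<open>
  The last argument of \<open>\<mu> i\<close> is \<open>\<gamma>u i r\<close>. With \<open>\<gamma>u = (\<lambda>i v. v)\<close> the number \<open>r\<close> itself is
  inserted there; this variant is used for the bound on \<open>V\<close> in terms of
  \<open>\<phi>\<^sup>-\<^sup>1 (\<gamma>\<^sub>i\<^sub>u (\<parallel>u\<parallel>))\<close>, in which the input gains are already accounted for.
\<close>

definition gain_op_bar ::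
    "('n::finite \<Rightarrow> real ^ 'n option \<Rightarrow> real) \<Rightarrow> ('n \<Rightarrow> 'n \<Rightarrow> real \<Rightarrow> real) \<Rightarrow> ('n \<Rightarrow> real \<Rightarrow> real)
      \<Rightarrow> real ^ 'n \<Rightarrow> real \<Rightarrow> real ^ 'n" where
  "gain_op_bar \<mu> \<gamma> \<gamma>u s r = (\<chi> i. \<mu> i (vjoin (\<chi> j. \<gamma> i j (s $ j)) (\<gamma>u i r)))"

definition gain_op ::
    "('n::finite \<Rightarrow> real ^ 'n option \<Rightarrow> real) \<Rightarrow> ('n \<Rightarrow> 'n \<Rightarrow> real \<Rightarrow> real) \<Rightarrow> ('n \<Rightarrow> real \<Rightarrow> real)
      \<Rightarrow> real ^ 'n \<Rightarrow> real ^ 'n" where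
  "gain_op \<mu> \<gamma> \<gamma>u s = gain_op_bar \<mu> \<gamma> \<gamma>u s 0"

text \<open>
  In the second part, the restriction of \<open>\<lambda>s. \<mu> i (s, 0)\<close> to the arguments \<open>j\<close> with
  nonzero \<open>\<gamma> i j\<close> is expressed by vectors whose other entries vanish.
\<close>

definition compatible ::
    "('n::finite \<Rightarrow> real ^ 'n option \<Rightarrow> real) \<Rightarrow> ('n \<Rightarrow> 'n \<Rightarrow> real \<Rightarrow> real) \<Rightarrow> bool" where
  "compatible \<mu> \<gamma> \<longleftrightarrow>
     (\<forall>i. \<forall>s\<in>orthant. \<forall>t\<in>orthant. vless s t \<longrightarrow> \<mu> i (vjoin s 0) < \<mu> i (vjoin t 0)) \<and>
     (\<forall>i. (\<exists>j. \<not> zero_gain (\<gamma> i j)) \<longrightarrow>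
       (\<forall>s\<in>orthant. \<forall>t\<in>orthant.
          (\<forall>j. if zero_gain (\<gamma> i j) then s $ j = 0 \<and> t $ j = 0 else s $ j < t $ j)
          \<longrightarrow> \<mu> i (vjoin s 0) < \<mu> i (vjoin t 0)))"

definition Omega_path :: "(real ^ 'n::finite \<Rightarrow> real ^ 'n) \<Rightarrow> ('n \<Rightarrow> real \<Rightarrow> real) \<Rightarrow> bool" where
  "Omega_path T \<sigma> \<longleftrightarrow>
     (\<forall>i. class_Kinf (\<sigma> i)) \<and>
     (\<forall>i. locally_lipschitz_on {0<..} (Kinv (\<sigma> i))) \<and>
     (\<forall>K. compact K \<and> K \<subseteq> {0<..} \<longrightarrow>
        (\<exists>c C. 0 < c \<and> c < C \<and>
          (\<forall>i. \<forall>r\<in>K. \<forall>d. (Kinv (\<sigma> i) has_real_derivative d) (at r) \<longrightarrow> c \<le> d \<and> d \<le> C))) \<and>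
     (\<forall>r>0. vless (T (\<chi> i. \<sigma> i r)) (\<chi> i. \<sigma> i r))"


section \<open>Interconnected systems\<close>

text \<open>
  The overall state space is \<open>real ^ 'k\<close>, and \<open>b :: 'k \<Rightarrow> 'n\<close> assigns to each coordinate the
  subsystem to which it belongs. The state space of subsystem \<open>i\<close>, of dimension
  \<open>card {k. b k = i}\<close>, is the coordinate subspace \<open>block b i\<close>; the component \<open>x\<^sub>i\<close> of a state
  \<open>x\<close> is \<open>part b i x\<close>, and \<open>f\<^sub>i (x, u)\<close> is \<open>part b i (f x u)\<close>. In this way the dimensions
  of the subsystems may be different.
\<close>

definition block :: "('k::finite \<Rightarrow> 'n) \<Rightarrow> 'n \<Rightarrow> (real ^ 'k) set" where
  "block b i = {x. \<forall>k. b k \<noteq> i \<longrightarrow> x $ k = 0}"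

definition part :: "('k::finite \<Rightarrow> 'n) \<Rightarrow> 'n \<Rightarrow> real ^ 'k \<Rightarrow> real ^ 'k" where
  "part b i x = (\<chi> k. if b k = i then x $ k else 0)"

definition Linf_input :: "(real \<Rightarrow> 'a::euclidean_space) \<Rightarrow> bool" where
  "Linf_input w \<longleftrightarrow>
     w \<in> borel_measurable (lebesgue_on {0..}) \<and>
     (\<exists>B. AE t in lebesgue_on {0..}. norm (w t) \<le> B)"

text \<open>
  A solution is meant in the sense of Caratheodory (locally absolutely continuous, satisfying
  the differential equation almost everywhere), written in integrated form. In the input
  \<open>w\<close> of subsystem \<open>i\<close>, which supplies the \<open>x\<^sub>j\<close> for \<open>j \<noteq> i\<close>, the coordinates of block \<open>i\<close>
  are ignored.
\<close>

definition subsystem_solution ::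
    "('k::finite \<Rightarrow> 'n) \<Rightarrow> (real ^ 'k \<Rightarrow> real ^ 'm::finite \<Rightarrow> real ^ 'k) \<Rightarrow> 'n
      \<Rightarrow> (real \<Rightarrow> real ^ 'k) \<Rightarrow> (real \<Rightarrow> real ^ 'm) \<Rightarrow> real ^ 'k \<Rightarrow> (real \<Rightarrow> real ^ 'k) \<Rightarrow> bool" where
  "subsystem_solution b f i w u x0 x \<longleftrightarrow>
     (let g = (\<lambda>s. part b i (f (\<chi> k. if b k = i then x s $ k else w s $ k) (u s)))
      in \<forall>t\<ge>0. g absolutely_integrable_on {0..t} \<and> x t = x0 + integral {0..t} g)"

definition subsystem_wellposed ::
    "('k::finite \<Rightarrow> 'n) \<Rightarrow> (real ^ 'k \<Rightarrow> real ^ 'm::finite \<Rightarrow> real ^ 'k) \<Rightarrow> 'n \<Rightarrow> bool" where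
  "subsystem_wellposed b f i \<longleftrightarrow>
     (\<forall>w u. \<forall>x0\<in>block b i. Linf_input w \<and> Linf_input u \<longrightarrow>
        (\<exists>x. subsystem_solution b f i w u x0 x) \<and>
        (\<forall>x y. subsystem_solution b f i w u x0 x \<and> subsystem_solution b f i w u x0 y
           \<longrightarrow> (\<forall>t\<ge>0. x t = y t)))"


section \<open>ISS Lyapunov functions\<close>

text \<open>
  Candidates are defined on a linear subspace \<open>S\<close>, which is the whole space or a block.
  Values outside \<open>S\<close> are irrelevant.
\<close>

definition lyapunov_candidate_on :: "'a::euclidean_space set \<Rightarrow> ('a \<Rightarrow> real) \<Rightarrow> bool" where
  "lyapunov_candidate_on S V \<longleftrightarrow>
     continuous_on S V \<and>
     (\<exists>\<psi>1 \<psi>2. class_Kinf \<psi>1 \<and> class_Kinf \<psi>2 \<and>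
        (\<forall>x\<in>S. \<psi>1 (norm x) \<le> V x \<and> V x \<le> \<psi>2 (norm x))) \<and>
     locally_lipschitz_on (S - {0}) V"

text \<open>
  Here and below the derivative \<open>D\<close> of a real function is the linear map given by its
  gradient, so \<open>D (f x u)\<close> is \<open>\<nabla>V(x) f(x,u)\<close>.
\<close>

definition decreasing_with_gain ::
    "('a::euclidean_space \<Rightarrow> 'u::euclidean_space \<Rightarrow> 'a) \<Rightarrow> ('a \<Rightarrow> real) \<Rightarrow> (real \<Rightarrow> real) \<Rightarrow> bool" where
  "decreasing_with_gain f V \<gamma> \<longleftrightarrow>
     (\<exists>\<alpha>. pos_def_fun \<alpha> \<and>
        (\<forall>x u D. (V has_derivative D) (at x) \<longrightarrow> V x \<ge> \<gamma> (norm u)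
           \<longrightarrow> D (f x u) \<le> - \<alpha> (norm x)))"

definition iss_lyapunov ::
    "('a::euclidean_space \<Rightarrow> 'u::euclidean_space \<Rightarrow> 'a) \<Rightarrow> ('a \<Rightarrow> real) \<Rightarrow> bool" where
  "iss_lyapunov f V \<longleftrightarrow>
     lyapunov_candidate_on UNIV V \<and> (\<exists>\<gamma>. class_K \<gamma> \<and> decreasing_with_gain f V \<gamma>)"

text \<open>
  The derivative within \<open>block b i\<close> is unique as a linear map on that subspace, which
  contains the vector to which it is applied.
\<close>

definition subsystem_iss_lyapunov ::
    "('k::finite \<Rightarrow> 'n::finite) \<Rightarrow> (real ^ 'k \<Rightarrow> real ^ 'm::finite \<Rightarrow> real ^ 'k)
      \<Rightarrow> ('n \<Rightarrow> real ^ 'k \<Rightarrow> real) \<Rightarrow> ('n \<Rightarrow> real ^ 'n option \<Rightarrow> real)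
      \<Rightarrow> ('n \<Rightarrow> 'n \<Rightarrow> real \<Rightarrow> real) \<Rightarrow> ('n \<Rightarrow> real \<Rightarrow> real) \<Rightarrow> 'n \<Rightarrow> bool" where
  "subsystem_iss_lyapunov b f V \<mu> \<gamma> \<gamma>u i \<longleftrightarrow>
     (\<exists>\<alpha>. pos_def_fun \<alpha> \<and>
        (\<forall>x u D. (V i has_derivative D) (at (part b i x) within block b i) \<longrightarrow>
           V i (part b i x) \<ge> \<mu> i (vjoin (\<chi> j. \<gamma> i j (V j (part b j x))) (\<gamma>u i (norm u)))
           \<longrightarrow> D (part b i (f x u)) \<le> - \<alpha> (norm (part b i x))))"

definition overall_V ::
    "('k::finite \<Rightarrow> 'n::finite) \<Rightarrow> ('n \<Rightarrow> real \<Rightarrow> real) \<Rightarrow> ('n \<Rightarrow> real ^ 'k \<Rightarrow> real) \<Rightarrow> real ^ 'k \<Rightarrow> real" where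
  "overall_V b \<sigma> V x = (MAX i. Kinv (\<sigma> i) (V i (part b i x)))"

end

theory Submission
  imports Defs
begin

text \<open>
  At a point \<open>x \<noteq> 0\<close> of differentiability of \<open>V\<close> put \<open>r = V x\<close>. If \<open>\<sigma>\<^sub>i\<^sup>-\<^sup>1 (V\<^sub>i (x\<^sub>i)) = r\<close>, then
  \<open>V\<^sub>i (x\<^sub>i) = \<sigma>\<^sub>i r\<close> strictly exceeds the gain term of \<open>V\<^sub>i\<close> at \<open>(x, u)\<close>, by the assumption on
  \<open>\<sigma>\<close> and \<open>\<phi>\<close> and monotonicity of \<open>\<mu>\<^sub>i\<close>. By continuity this persists for all \<open>y\<close> near \<open>x\<close>,
  so \<open>V\<^sub>i\<close> decreases along \<open>v = f (x, u)\<close> at all nearby points of differentiability, although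
  \<open>V\<^sub>i\<close> need not be differentiable at \<open>x\<^sub>i\<close> itself. Rademacher's theorem and Fubini turn this into
  a linear decrease of \<open>t \<mapsto> V\<^sub>i (x\<^sub>i + t v\<^sub>i)\<close>, which is transported to \<open>V\<close> by the lower bound on
  the slope of \<open>\<sigma>\<^sub>i\<^sup>-\<^sup>1\<close>. No generalised gradients are needed. The decrease rate is bounded below
  on every annulus around the origin, which suffices for a positive definite \<open>\<alpha>\<close>.
\<close>

section \<open>Differentiability of Lipschitz functions on the line\<close>

text \<open>Continuity of f in the state and the Lipschitz bound on derivatives of
  \<open>V i\<close> make the discrepancy smaller than any prescribed loss of decay rate.

  The measure theory rests on one Vitali covering estimate for increasing Lipschitz functions of a
  real variable, \<open>emeasure_image_le_slope\<close>. It bounds the size of an image by slopes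
  that occur at arbitrarily small scales. It yields both differentiability almost everywhere and a
  mean value inequality with an exceptional null set, so no derivative has to be integrated along a
  segment.

  The two parts of the theorem differ only in the threshold on \<open>norm u\<close>. Each premise
  on \<open>\<phi>\<close> is converted into the predicate \<open>dominated\<close>, on which the
  whole decay argument is based. If \<open>\<phi> r\<close> passes through \<open>\<gamma>u\<close>,
  the threshold is \<open>Kinv \<phi> (norm u)\<close>; if it is inserted directly, the threshold is
  the maximum of \<open>Kinv \<phi> (\<gamma>u i (norm u))\<close>.\<close>

lemma lipschitz_image_negligible:
  fixes f :: "'a::euclidean_space \<Rightarrow> 'a"
  assumes "L-lipschitz_on UNIV f" "negligible N"
  shows "negligible (f ` N)"
proof (rule negligible_locally_Lipschitz_image[OF _ assms(2)])
  show "\<exists>T B. open T \<and> x \<in> T \<and> (\<forall>y \<in> N \<inter> T. norm (f y - f x) \<le> B * norm (y - x))" for x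
    using lipschitz_onD[OF assms(1)] by (intro exI[of _ UNIV] exI[of _ L]) (auto simp: dist_norm)
qed simp

text \<open>The short intervals with mean slope at most \<open>p\<close> form a Vitali cover of
  \<open>S\<close>. A countable disjoint subfamily covers \<open>S\<close> up to a null set, and its
  images are disjoint intervals of total length at most \<open>p\<close> times the measure of
  \<open>U\<close>. A measurable superset \<open>T\<close> is produced because \<open>S\<close> need
  not be measurable.\<close>

lemma emeasure_image_le_slope:
  fixes f :: "real \<Rightarrow> real"
  assumes mono: "strict_mono f" and lip: "L-lipschitz_on UNIV f"
    and U: "open U" "S \<subseteq> U" and p: "0 \<le> p"
    and slope: "\<And>x d. x \<in> S \<Longrightarrow> 0 < d \<Longrightarrow> \<exists>h. h \<noteq> 0 \<and> \<bar>h\<bar> < d \<and> (f (x + h) - f x) / h \<le> p"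
  shows "\<exists>T\<in>sets lebesgue. f ` S \<subseteq> T \<and> emeasure lebesgue T \<le> ennreal p * emeasure lebesgue U"
proof -
  define K where "K = {(c, r). 0 < r \<and> cball c r \<subseteq> U \<and> f (c + r) - f (c - r) \<le> p * (2 * r)}"
  have cover: "\<exists>i. i \<in> K \<and> x \<in> cball (fst i) (snd i) \<and> snd i < d" if x: "x \<in> S" and d: "0 < d" for x d
  proof -
    obtain e where e: "e > 0" "ball x e \<subseteq> U"
      using x U open_contains_ball by blast
    obtain h where h: "h \<noteq> 0" "\<bar>h\<bar> < min d e" "(f (x + h) - f x) / h \<le> p"
      using slope[OF x, of "min d e"] d e by auto
    \<comment> \<open>This is the interval between x and x + h for either sign of h, so x is one of
      its endpoints.\<close>
    have "(x + h / 2, \<bar>h\<bar> / 2) \<in> K"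
    proof -
      have "cball (x + h / 2) (\<bar>h\<bar> / 2) \<subseteq> ball x e"
        using h by (auto simp: dist_real_def abs_real_def split: if_splits)
      moreover have "f (x + h / 2 + \<bar>h\<bar> / 2) - f (x + h / 2 - \<bar>h\<bar> / 2) \<le> p * (2 * (\<bar>h\<bar> / 2))"
      proof -
        have "f (x + h / 2 + h / 2) = f (x + h)" "f (x + h / 2 - h / 2) = f x"
          by (simp_all add: add.commute)
        then show ?thesis using h(1,3) by (cases "h > 0") (auto simp: pos_divide_le_eq neg_divide_le_eq mult.commute)
      qed
      ultimately show ?thesis using e h by (auto simp: K_def)
    qed
    moreover have "x \<in> cball (x + h / 2) (\<bar>h\<bar> / 2)" by (auto simp: dist_real_def)
    ultimately show ?thesis using h by (intro exI[of _ "(x + h / 2, \<bar>h\<bar> / 2)"]) auto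
  qed
  have pos: "0 < snd i" if "i \<in> K" for i using that by (auto simp: K_def)
  obtain C where C: "countable C" "C \<subseteq> K"
     "pairwise (\<lambda>i j. disjnt (cball (fst i) (snd i)) (cball (fst j) (snd j))) C"
     and neg: "negligible (S - (\<Union>i \<in> C. cball (fst i) (snd i)))"
    using Vitali_covering_theorem_cballs[of K snd S fst, OF pos cover] by blast
  let ?I = "\<lambda>i. cball (fst i) (snd i)"
  let ?N = "S - (\<Union>i \<in> C. ?I i)"
  have cont: "continuous_on X f" for X
    using lipschitz_on_continuous_on[OF lip] continuous_on_subset by blast
  have img: "f ` ?I i = {f (fst i - snd i) .. f (fst i + snd i)}" if "i \<in> C" for i
  proof
    have le: "fst i - snd i \<le> fst i + snd i" using that C(2) by (auto simp: K_def)
    show "f ` ?I i \<subseteq> {f (fst i - snd i)..f (fst i + snd i)}"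
      using mono by (auto simp: cball_eq_atLeastAtMost strict_mono_less_eq)
    show "{f (fst i - snd i)..f (fst i + snd i)} \<subseteq> f ` ?I i"
      using IVT'[of f "fst i - snd i" _ "fst i + snd i", OF _ _ le cont]
      by (fastforce simp: cball_eq_atLeastAtMost)
  qed
  have dis: "disjoint_family_on ?I C"
    using C(3) by (auto simp: disjoint_family_on_def pairwise_def disjnt_def)
  have disf: "disjoint_family_on (\<lambda>i. f ` ?I i) C"
    using dis strict_mono_imp_inj_on[OF mono] unfolding disjoint_family_on_def
    by (metis image_Int image_empty)
  \<comment> \<open>The Lipschitz property is essential here: a function that is merely continuous
    and increasing may map a null set to a set of positive measure.\<close>
  have fN: "f ` ?N \<in> null_sets lebesgue"
    using lipschitz_image_negligible[OF lip neg] negligible_iff_null_sets by blast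
  have mf: "f ` ?I i \<in> sets lebesgue" if "i \<in> C" for i using img[OF that] by simp
  let ?T = "(\<Union>i\<in>C. f ` ?I i) \<union> f ` ?N"
  have meas: "(\<Union>i\<in>C. f ` ?I i) \<in> sets lebesgue"
    using C(1) mf by (intro sets.countable_UN'') auto
  have "emeasure lebesgue ?T = emeasure lebesgue (\<Union>i\<in>C. f ` ?I i)"
    using emeasure_Un_null_set[OF meas fN] .
  also have "\<dots> = (\<integral>\<^sup>+i. emeasure lebesgue (f ` ?I i) \<partial>count_space C)"
    by (rule emeasure_UN_countable[OF mf C(1) disf])
  also have "\<dots> \<le> (\<integral>\<^sup>+i. ennreal p * emeasure lebesgue (?I i) \<partial>count_space C)"
  proof (rule nn_integral_mono)
    fix i assume "i \<in> space (count_space C)"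
    then have i: "i \<in> C" by simp
    then have k: "0 < snd i" "f (fst i + snd i) - f (fst i - snd i) \<le> p * (2 * snd i)"
      using C(2) by (auto simp: K_def)
    have "f (fst i - snd i) \<le> f (fst i + snd i)" using mono k(1) by (simp add: strict_mono_less_eq)
    then show "emeasure lebesgue (f ` ?I i) \<le> ennreal p * emeasure lebesgue (?I i)"
      using k p unfolding img[OF i] unfolding cball_eq_atLeastAtMost by (simp flip: ennreal_mult)
  qed
  also have "\<dots> = ennreal p * (\<integral>\<^sup>+i. emeasure lebesgue (?I i) \<partial>count_space C)"
    by (rule nn_integral_cmult) simp
  also have "(\<integral>\<^sup>+i. emeasure lebesgue (?I i) \<partial>count_space C) = emeasure lebesgue (\<Union>i\<in>C. ?I i)"
    by (rule emeasure_UN_countable[symmetric, OF _ C(1) dis]) auto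
  also have "\<dots> \<le> emeasure lebesgue U"
  proof (intro emeasure_mono UN_least)
    show "?I i \<subseteq> U" if "i \<in> C" for i using that C(2) by (cases i) (auto simp: K_def)
  qed (use U in simp)
  finally have "emeasure lebesgue ?T \<le> ennreal p * emeasure lebesgue U"
    by (simp add: mult_left_mono)
  moreover have "?T \<in> sets lebesgue" using meas fN by blast
  moreover have "f ` S \<subseteq> ?T" by blast
  ultimately show ?thesis by blast
qed


text \<open>For p < q these are points at which the difference quotient in direction
  \<open>v\<close> oscillates across the interval from p to q. A bounded quotient that does so for
  no rational p < q converges. Using \<open>frequently\<close> instead of upper and lower limits
  makes Borel measurability direct.\<close>

definition straddle :: "('a::euclidean_space \<Rightarrow> real) \<Rightarrow> 'a \<Rightarrow> real \<Rightarrow> real \<Rightarrow> 'a set" where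
  "straddle f v p q = {x. (\<exists>\<^sub>F h in at 0. (f (x + h *\<^sub>R v) - f x) / h < p)
                        \<and> (\<exists>\<^sub>F h in at 0. q < (f (x + h *\<^sub>R v) - f x) / h)}"

text \<open>Only the scales 1 / (n + 1) have to be countable: the union over all h at a given scale
  is uncountable, but it is a union of open sets.\<close>

lemma borel_frequently_at_0:
  fixes Q :: "'a::euclidean_space \<Rightarrow> real \<Rightarrow> real"
  assumes "\<And>h. h \<noteq> 0 \<Longrightarrow> continuous_on UNIV (\<lambda>x. Q x h)"
  shows "{x. \<exists>\<^sub>F h in at 0. Q x h < p} \<in> sets borel"
proof -
  have eq: "{x. \<exists>\<^sub>F h in at 0. Q x h < p} =
      (\<Inter>n. \<Union>h\<in>{h. h \<noteq> 0 \<and> \<bar>h\<bar> < 1 / real (Suc n)}. {x. Q x h < p})" (is "?A = ?B")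
  proof (intro equalityI subsetI)
    fix x assume "x \<in> ?A"
    then have *: "\<And>d. d > 0 \<Longrightarrow> \<exists>h. h \<noteq> 0 \<and> \<bar>h\<bar> < d \<and> Q x h < p"
      by (auto simp: frequently_at dist_real_def)
    have "\<exists>h. h \<noteq> 0 \<and> \<bar>h\<bar> < 1 / real (Suc n) \<and> Q x h < p" for n
      by (rule *) simp
    then show "x \<in> ?B" by blast
  next
    fix x assume x: "x \<in> ?B"
    show "x \<in> ?A" unfolding mem_Collect_eq frequently_at
    proof (intro allI impI)
      fix d :: real assume "d > 0"
      then obtain n where n: "1 / real (Suc n) < d" using nat_approx_posE by blast
      from x have "x \<in> (\<Union>h\<in>{h. h \<noteq> 0 \<and> \<bar>h\<bar> < 1 / real (Suc n)}. {x. Q x h < p})" by blast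
      then obtain h where "h \<noteq> 0" "\<bar>h\<bar> < 1 / real (Suc n)" "Q x h < p" by blast
      then show "\<exists>h\<in>UNIV. h \<noteq> 0 \<and> dist h 0 < d \<and> Q x h < p"
        using n by (intro bexI[of _ h]) (auto simp: dist_real_def)
    qed
  qed
  have "open (\<Union>h\<in>{h. h \<noteq> 0 \<and> \<bar>h\<bar> < 1 / real (Suc n)}. {x. Q x h < p})" for n
    using assms by (intro open_UN ballI open_Collect_less continuous_on_const) auto
  then show ?thesis unfolding eq by (intro sets.countable_INT'' borel_open) auto
qed

lemma borel_straddle:
  fixes f :: "'a::euclidean_space \<Rightarrow> real"
  assumes "continuous_on UNIV f"
  shows "straddle f v p q \<in> sets borel"
proof -
  let ?Q = "\<lambda>x h. (f (x + h *\<^sub>R v) - f x) / h"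
  have c: "continuous_on UNIV (\<lambda>x. ?Q x h)" if "h \<noteq> 0" for h
    using that by (intro continuous_intros continuous_on_compose2[OF assms]) auto
  have "straddle f v p q = {x. \<exists>\<^sub>F h in at 0. ?Q x h < p} \<inter> {x. \<exists>\<^sub>F h in at 0. - ?Q x h < - q}"
    by (auto simp: straddle_def)
  also have "\<dots> \<in> sets borel"
    using c by (intro sets.Int borel_frequently_at_0 continuous_on_minus) auto
  finally show ?thesis .
qed

section \<open>Almost everywhere convergence of difference quotients on the line\<close>

lemma open_superset_emeasure_le:
  assumes "S \<in> sets lebesgue" "0 < e"
  obtains U where "open U" "S \<subseteq> U" "emeasure lebesgue U \<le> emeasure lebesgue S + ennreal e"
proof -
  obtain U where U: "open U" "S \<subseteq> U" "U - S \<in> lmeasurable" "emeasure lebesgue (U - S) < ennreal e"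
    using sets_lebesgue_outer_open[OF assms] by metis
  have "emeasure lebesgue U = emeasure lebesgue (S \<union> (U - S))" using U(2) by (simp add: Un_absorb1)
  also have "\<dots> \<le> emeasure lebesgue S + emeasure lebesgue (U - S)"
    using assms(1) U(3) by (intro emeasure_subadditive) auto
  also have "\<dots> \<le> emeasure lebesgue S + ennreal e" using U(4) by (intro add_left_mono) simp
  finally show ?thesis using that U by blast
qed

text \<open>Where both slopes occur at all scales, the image measure is at most \<open>p\<close> times and, by the
  same bound for the inverse function, at least \<open>q\<close> times the measure.\<close>

lemma negligible_straddle_bilipschitz:
  fixes f :: "real \<Rightarrow> real"
  assumes lip: "L-lipschitz_on UNIV f" and expand: "\<And>x y. x \<le> y \<Longrightarrow> y - x \<le> f y - f x"
    and pq: "0 < p" "p < q"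
  shows "negligible (straddle f 1 p q)"
proof -
  have mono: "strict_mono f"
    by (rule strict_monoI) (use expand in \<open>smt (verit)\<close>)
  have cont: "continuous_on X f" for X
    using lipschitz_on_continuous_on[OF lip] continuous_on_subset by blast
  have surj: "surj f"
    unfolding surj_def
  proof
    fix y
    have "\<exists>x\<ge>- \<bar>y - f 0\<bar>. x \<le> \<bar>y - f 0\<bar> \<and> f x = y"
      using expand[of "- \<bar>y - f 0\<bar>" 0] expand[of 0 "\<bar>y - f 0\<bar>"] by (intro IVT' cont) auto
    then show "\<exists>x. y = f x" by blast
  qed
  define g where "g = inv f"
  have fg: "f (g y) = y" and gf: "g (f x) = x" for x y
    using surj strict_mono_imp_inj_on[OF mono] by (auto simp: g_def surj_f_inv_f inv_f_f)
  have gmono: "strict_mono g"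
    by (rule strict_monoI) (metis fg mono strict_mono_less)
  have glip: "1-lipschitz_on UNIV g"
  proof (rule lipschitz_onI)
    fix x y :: real
    show "dist (g x) (g y) \<le> 1 * dist x y"
      using expand[of "g x" "g y"] expand[of "g y" "g x"] fg
      by (cases "g x \<le> g y") (auto simp: dist_real_def)
  qed simp
  let ?A = "straddle f 1 p q"
  have small_p: "\<exists>h. h \<noteq> 0 \<and> \<bar>h\<bar> < d \<and> (f (x + h) - f x) / h \<le> p" if "x \<in> ?A" "0 < d" for x d
    using that by (force simp: straddle_def frequently_at dist_real_def)
  \<comment> \<open>A quotient of \<open>f\<close> above \<open>q\<close> with step h is a quotient
    of the inverse below \<open>1 / q\<close> with step k, the increment of \<open>f\<close>. The
    bound \<open>d / (L + 1)\<close> on h makes k smaller than \<open>d\<close>; the summand 1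
    avoids division by zero.\<close>
  have small_q: "\<exists>k. k \<noteq> 0 \<and> \<bar>k\<bar> < d \<and> (g (y + k) - g y) / k \<le> 1 / q"
    if y: "y \<in> f ` ?A" and d: "0 < d" for y d
  proof -
    obtain x where x: "x \<in> ?A" "y = f x" using y by blast
    have L: "0 \<le> L" using lip by (rule lipschitz_on_nonneg)
    have "0 < d / (L + 1)" using d L by simp
    then obtain h where h: "h \<noteq> 0" "\<bar>h\<bar> < d / (L + 1)" "q < (f (x + h) - f x) / h"
      using x(1) by (force simp: straddle_def frequently_at dist_real_def)
    define k where "k = f (x + h) - f x"
    have "k \<noteq> 0" using h(1) mono by (simp add: k_def strict_mono_eq)
    have "\<bar>k\<bar> \<le> L * \<bar>h\<bar>"
      using lipschitz_onD[OF lip, of "x + h" x] by (simp add: k_def dist_real_def)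
    also have "\<dots> \<le> (L + 1) * \<bar>h\<bar>" by (intro mult_right_mono) auto
    also have "\<dots> < d" using h(2) L by (simp add: field_simps)
    finally have "\<bar>k\<bar> < d" .
    moreover have "g (y + k) - g y = h" using x by (simp add: k_def gf)
    moreover have "h / k \<le> 1 / q"
    proof -
      have "q < k / h" using h by (simp add: k_def)
      then have "inverse (k / h) \<le> inverse q" using pq by (intro le_imp_inverse_le) auto
      then show ?thesis by (simp add: field_simps)
    qed
    ultimately show ?thesis using \<open>k \<noteq> 0\<close> by auto
  qed
  \<comment> \<open>The truncation makes the measure s finite, so that q s \<le> p s forces s =
    0.\<close>
  have "negligible (?A \<inter> {-real n..real n})" for n
  proof -
    let ?S = "?A \<inter> {-real n..real n}"
    have S: "?S \<in> lmeasurable"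
      using borel_straddle[OF cont, of 1 p q]
      by (intro bounded_set_imp_lmeasurable sets.Int bounded_Int disjI2) auto
    define s where "s = measure lebesgue ?S"
    have es: "emeasure lebesgue ?S = ennreal s" and s0: "0 \<le> s"
      using S by (auto simp: s_def emeasure_eq_measure2)
    \<comment> \<open>The covering estimate is applied to \<open>f\<close>, then to its inverse on
      the image; each \<open>e\<close> is the excess of an open superset.\<close>
    have key: "s \<le> (1 / q) * (p * (s + e) + e)" if e: "e > 0" for e
    proof -
      obtain U where U: "open U" "?S \<subseteq> U" "emeasure lebesgue U \<le> ennreal s + ennreal e"
        using open_superset_emeasure_le[of ?S e] S e es by (metis fmeasurableD)
      obtain T where T: "T \<in> sets lebesgue" "f ` ?S \<subseteq> T"
        "emeasure lebesgue T \<le> ennreal p * emeasure lebesgue U"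
      proof -
        have "\<exists>T\<in>sets lebesgue. f ` ?S \<subseteq> T \<and>
            emeasure lebesgue T \<le> ennreal p * emeasure lebesgue U"
          by (rule emeasure_image_le_slope[OF mono lip U(1,2)]) (use pq small_p in auto)
        then show ?thesis using that by blast
      qed
      obtain U' where U': "open U'" "T \<subseteq> U'" "emeasure lebesgue U' \<le> emeasure lebesgue T + ennreal e"
        using open_superset_emeasure_le[OF T(1) e] by metis
      obtain T' where T': "T' \<in> sets lebesgue" "g ` (f ` ?S) \<subseteq> T'"
        "emeasure lebesgue T' \<le> ennreal (1 / q) * emeasure lebesgue U'"
      proof -
        have "\<exists>T'\<in>sets lebesgue. g ` (f ` ?S) \<subseteq> T' \<and>
            emeasure lebesgue T' \<le> ennreal (1 / q) * emeasure lebesgue U'"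
          by (rule emeasure_image_le_slope[OF gmono glip U'(1)])
            (use T(2) U'(2) pq small_q in blast, use pq in simp, use small_q in blast)
        then show ?thesis using that by blast
      qed
      have "?S \<subseteq> T'" using T'(2) by (simp add: image_image gf)
      then have "ennreal s \<le> emeasure lebesgue T'"
        unfolding es[symmetric] using T'(1) by (intro emeasure_mono)
      also have "\<dots> \<le> ennreal (1 / q) * (ennreal p * (ennreal s + ennreal e) + ennreal e)"
        by (intro order_trans[OF T'(3)] mult_left_mono order_trans[OF U'(3)] add_mono
            order_trans[OF T(3)] U(3)) auto
      also have "\<dots> = ennreal ((1 / q) * (p * (s + e) + e))"
        using pq s0 e by (simp add: ennreal_plus[symmetric] ennreal_mult[symmetric] del: ennreal_plus)
      finally show ?thesis
        using pq s0 e by (subst (asm) ennreal_le_iff) auto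
    qed
    have "s = 0"
    proof (rule ccontr)
      assume "s \<noteq> 0"
      \<comment> \<open>With this choice the total error \<open>e * (p + 1)\<close> is half of the
        gap \<open>(q - p) * s\<close>.\<close>
      define e where "e = (q - p) * s / 2 / (p + 1)"
      have e: "e > 0" "e * (p + 1) = (q - p) * s / 2"
        using \<open>s \<noteq> 0\<close> s0 pq by (auto simp: e_def field_simps)
      have "q * s \<le> p * (s + e) + e" using key[OF e(1)] pq by (simp add: field_simps)
      also have "\<dots> = p * s + (q - p) * s / 2" using e(2) by (simp add: algebra_simps)
      finally have "(q - p) * s \<le> 0" by (simp add: field_simps)
      then show False using \<open>s \<noteq> 0\<close> s0 pq by (simp add: mult_le_0_iff)
    qed
    then show ?thesis using S es by (auto simp: negligible_iff_null_sets null_sets_def)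
  qed
  then have "negligible (\<Union>n. ?A \<inter> {-real n..real n})" by (intro negligible_Union_nat)
  moreover have "?A \<subseteq> (\<Union>n. ?A \<inter> {-real n..real n})"
  proof
    fix x assume "x \<in> ?A"
    moreover obtain n where "\<bar>x\<bar> \<le> real n" using real_arch_simple by blast
    ultimately have "x \<in> ?A \<inter> {-real n..real n}" by auto
    then show "x \<in> (\<Union>n. ?A \<inter> {-real n..real n})" by blast
  qed
  ultimately show ?thesis using negligible_subset by blast
qed

text \<open>Adding \<open>(L + 1) * x\<close> makes the function expanding and shifts all difference
  quotients, hence both thresholds, by \<open>L + 1\<close>.\<close>

lemma negligible_straddle_real:
  fixes g :: "real \<Rightarrow> real"
  assumes lip: "L-lipschitz_on UNIV g" and pq: "p < q"
  shows "negligible (straddle g 1 p q)"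
proof (cases "straddle g 1 p q = {}")
  case False
  have gL: "\<bar>g x - g y\<bar> \<le> L * \<bar>x - y\<bar>" for x y
    using lipschitz_onD[OF lip, of x y] by (simp add: dist_real_def)
  define f where "f = (\<lambda>x. g x + (L + 1) * x)"
  \<comment> \<open>The bilipschitz case needs a positive lower threshold. A straddling point has a
    quotient below \<open>p\<close>, and no quotient is below \<open>-L\<close>.\<close>
  obtain x where "x \<in> straddle g 1 p q" using False by blast
  then obtain h where h: "h \<noteq> 0" "(g (x + h) - g x) / h < p"
    by (force simp: straddle_def frequently_at intro: zero_less_one)
  have "\<bar>(g (x + h) - g x) / h\<bar> \<le> L"
    using gL[of "x + h" x] h(1) by (simp add: divide_le_eq abs_divide)
  then have p: "0 < p + (L + 1)" using h(2) by linarith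
  have "straddle f 1 (p + (L + 1)) (q + (L + 1)) = straddle g 1 p q"
  proof -
    have "(f (x + h) - f x) / h = (g (x + h) - g x) / h + (L + 1)" if "h \<noteq> 0" for x h
      using that by (simp add: f_def field_simps)
    then have "(f (x + h) - f x) / h < p + (L + 1) \<longleftrightarrow> (g (x + h) - g x) / h < p"
      "q + (L + 1) < (f (x + h) - f x) / h \<longleftrightarrow> q < (g (x + h) - g x) / h" if "h \<noteq> 0" for x h
      using that by simp_all
    then show ?thesis
      by (simp add: straddle_def frequently_at cong: conj_cong)
  qed
  moreover have "negligible (straddle f 1 (p + (L + 1)) (q + (L + 1)))"
  proof (rule negligible_straddle_bilipschitz)
    have "L \<ge> 0" using lip by (rule lipschitz_on_nonneg)
    then show "(L + (L + 1))-lipschitz_on UNIV f" unfolding f_def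
      by (intro lipschitz_on_add lip lipschitz_on_cmult_real_nonneg[of 1 _ _ "L + 1", simplified] lipschitz_on_id) auto
    show "y - x \<le> f y - f x" if "x \<le> y" for x y
      using gL[of y x] that by (simp add: f_def algebra_simps)
  qed (use p pq in auto)
  ultimately show ?thesis by simp
qed simp

text \<open>The limit is the lower limit, written as the supremum of the eventual lower bounds. If
  the quotient did not stay below some a > l, it would oscillate across two rationals between l and
  a.\<close>

lemma bounded_tendsto_if_not_straddling:
  fixes Q :: "real \<Rightarrow> real"
  assumes bdd: "\<And>h. \<bar>Q h\<bar> \<le> L"
    and ns: "\<And>p q. p \<in> \<rat> \<Longrightarrow> q \<in> \<rat> \<Longrightarrow> p < q \<Longrightarrow>
      \<not> ((\<exists>\<^sub>F h in at 0. Q h < p) \<and> (\<exists>\<^sub>F h in at 0. q < Q h))"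
  shows "\<exists>l. (Q \<longlongrightarrow> l) (at 0)"
proof -
  define S where "S = {p. \<forall>\<^sub>F h in at 0. p \<le> Q h}"
  have nt: "at (0::real) \<noteq> bot" by simp
  have "- L \<in> S" using bdd by (auto simp: S_def abs_le_iff minus_le_iff intro!: always_eventually)
  have le: "p \<le> L" if "p \<in> S" for p
  proof -
    have "\<exists>h. p \<le> Q h" by (rule eventually_happens'[OF nt]) (use that in \<open>simp add: S_def\<close>)
    then obtain h where "p \<le> Q h" ..
    then show ?thesis using bdd[of h] by linarith
  qed
  have bS: "bdd_above S" using le by (auto simp: bdd_above_def)
  define l where "l = Sup S"
  have "(Q \<longlongrightarrow> l) (at 0)"
  proof (rule order_tendstoI)
    fix a assume "a < l"
    then obtain p where "p \<in> S" "a < p"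
      using less_cSup_iff[of S a] bS \<open>- L \<in> S\<close> by (auto simp: l_def)
    then show "\<forall>\<^sub>F h in at 0. a < Q h" unfolding S_def by (auto elim: eventually_mono)
  next
    fix a assume "l < a"
    then obtain p where p: "p \<in> \<rat>" "l < p" "p < a" using Rats_dense_in_real by blast
    then obtain q where q: "q \<in> \<rat>" "p < q" "q < a" using Rats_dense_in_real by blast
    have "p \<notin> S" using p(2) cSup_upper[OF _ bS] unfolding l_def by fastforce
    then have "\<exists>\<^sub>F h in at 0. Q h < p" by (simp add: S_def not_eventually not_le)
    then have "\<not> (\<exists>\<^sub>F h in at 0. q < Q h)" using ns[OF p(1) q(1,2)] by blast
    then show "\<forall>\<^sub>F h in at 0. Q h < a"
      using q(3) by (auto simp: not_frequently not_less elim: eventually_mono)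
  qed
  then show ?thesis by blast
qed


section \<open>Directional derivatives and Rademacher's theorem\<close>

text \<open>Tonelli and translation invariance: for fixed t the translate of \<open>N\<close> has
  the measure of \<open>N\<close>. The identity is used in both directions, to pass from lines to
  the space and back.\<close>

lemma nn_integral_lines:
  fixes v :: "'a::euclidean_space"
  assumes N[measurable]: "N \<in> sets borel" and T: "0 \<le> T"
  shows "(\<integral>\<^sup>+x. emeasure lborel {t\<in>{0..T}. x + t *\<^sub>R v \<in> N} \<partial>lborel) = ennreal T * emeasure lborel N"
proof -
  let ?F = "\<lambda>x t. indicator {0..T} t * indicator N (x + t *\<^sub>R v) :: ennreal"
  have F: "(\<lambda>(x, t). ?F x t) \<in> borel_measurable (lborel \<Otimes>\<^sub>M lborel)"
    by measurable
  have "emeasure lborel {t\<in>{0..T}. x + t *\<^sub>R v \<in> N} = (\<integral>\<^sup>+t. ?F x t \<partial>lborel)" for x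
  proof -
    have "{t\<in>{0..T}. x + t *\<^sub>R v \<in> N} \<in> sets lborel" by measurable
    then have "emeasure lborel {t\<in>{0..T}. x + t *\<^sub>R v \<in> N} =
        (\<integral>\<^sup>+t. indicator {t\<in>{0..T}. x + t *\<^sub>R v \<in> N} t \<partial>lborel)"
      by simp
    also have "\<dots> = (\<integral>\<^sup>+t. ?F x t \<partial>lborel)"
      by (intro nn_integral_cong) (auto simp: indicator_def)
    finally show ?thesis .
  qed
  then have "(\<integral>\<^sup>+x. emeasure lborel {t\<in>{0..T}. x + t *\<^sub>R v \<in> N} \<partial>lborel) = (\<integral>\<^sup>+x. \<integral>\<^sup>+t. ?F x t \<partial>lborel \<partial>lborel)"
    by simp
  also have "\<dots> = (\<integral>\<^sup>+t. \<integral>\<^sup>+x. ?F x t \<partial>lborel \<partial>lborel)"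
    by (rule lborel_pair.Fubini'[OF F, symmetric])
  also have "\<dots> = (\<integral>\<^sup>+t. indicator {0..T} t * emeasure lborel N \<partial>lborel)"
  proof (intro nn_integral_cong)
    fix t :: real
    have "(\<lambda>x. indicator N (x + t *\<^sub>R v) :: ennreal) \<in> borel_measurable lborel" by measurable
    then have "(\<integral>\<^sup>+x. ?F x t \<partial>lborel) = indicator {0..T} t * (\<integral>\<^sup>+x. indicator N (x + t *\<^sub>R v) \<partial>lborel)"
      by (rule nn_integral_cmult)
    also have "(\<integral>\<^sup>+x. indicator N (x + t *\<^sub>R v) \<partial>lborel) = (\<integral>\<^sup>+x. indicator N x \<partial>distr lborel borel ((+) (t *\<^sub>R v)))"
      by (subst nn_integral_distr) (auto simp: add.commute)
    finally show "(\<integral>\<^sup>+x. ?F x t \<partial>lborel) = indicator {0..T} t * emeasure lborel N"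
      by (simp add: lborel_distr_plus)
  qed
  also have "\<dots> = ennreal T * emeasure lborel N"
    using T by (simp add: nn_integral_multc)
  finally show ?thesis .
qed

lemma null_sets_if_null_on_lines:
  fixes v :: "'a::euclidean_space"
  assumes "N \<in> sets borel" and "\<And>x. negligible {t. x + t *\<^sub>R v \<in> N}"
  shows "N \<in> null_sets lborel"
proof -
  have "emeasure lborel {t\<in>{0..1}. x + t *\<^sub>R v \<in> N} = 0" for x
  proof -
    have "negligible {t\<in>{0..1}. x + t *\<^sub>R v \<in> N}"
      by (rule negligible_subset[OF assms(2)[of x]]) auto
    moreover have "{t\<in>{0..1}. x + t *\<^sub>R v \<in> N} \<in> sets borel"
      using assms(1) by measurable
    ultimately show ?thesis
      by (auto simp: negligible_iff_null_sets null_sets_def emeasure_completion)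
  qed
  then show ?thesis using nn_integral_lines[OF assms(1), of 1 v] assms(1) by (simp add: null_sets_def)
qed

lemma AE_lines_avoid_null_set:
  fixes v :: "'a::euclidean_space"
  assumes N: "N \<in> null_sets lborel" and T: "0 \<le> T"
  shows "AE x in lborel. negligible {t\<in>{0..T}. x + t *\<^sub>R v \<in> N}"
proof -
  have [measurable]: "N \<in> sets borel" using N by auto
  have [measurable]: "(\<lambda>x. emeasure lborel {t\<in>{0..T}. x + t *\<^sub>R v \<in> N}) \<in> borel_measurable lborel"
  proof -
    have "{p \<in> space (lborel \<Otimes>\<^sub>M lborel). snd p \<in> {0..T} \<and> fst p + snd p *\<^sub>R v \<in> N} \<in> sets (lborel \<Otimes>\<^sub>M (lborel::real measure))"
      by measurable
    from lborel.measurable_emeasure_Pair[OF this] show ?thesis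
      by (simp add: vimage_def space_pair_measure)
  qed
  have "(\<integral>\<^sup>+x. emeasure lborel {t\<in>{0..T}. x + t *\<^sub>R v \<in> N} \<partial>lborel) = 0"
    using N T by (subst nn_integral_lines) auto
  then have "AE x in lborel. emeasure lborel {t\<in>{0..T}. x + t *\<^sub>R v \<in> N} = 0"
    by (subst (asm) nn_integral_0_iff_AE) auto
  then show ?thesis
  proof (rule AE_mp, intro AE_I2 impI)
    fix x assume *: "emeasure lborel {t\<in>{0..T}. x + t *\<^sub>R v \<in> N} = 0"
    have "{t\<in>{0..T}. x + t *\<^sub>R v \<in> N} \<in> sets borel" by measurable
    with * show "negligible {t\<in>{0..T}. x + t *\<^sub>R v \<in> N}"
      by (auto simp: negligible_iff_null_sets null_sets_def emeasure_completion)
  qed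
qed

section \<open>Almost everywhere existence and additivity of directional derivatives\<close>

lemma lipschitz_on_line:
  fixes f :: "'a::real_normed_vector \<Rightarrow> real"
  assumes "L-lipschitz_on UNIV f"
  shows "(L * norm v)-lipschitz_on UNIV (\<lambda>t. f (x + t *\<^sub>R v))"
proof (rule lipschitz_onI)
  fix s t :: real
  have "dist (f (x + s *\<^sub>R v)) (f (x + t *\<^sub>R v)) \<le> L * dist (x + s *\<^sub>R v) (x + t *\<^sub>R v)"
    using assms by (rule lipschitz_onD) auto
  also have "dist (x + s *\<^sub>R v) (x + t *\<^sub>R v) = norm v * dist s t"
    by (simp add: dist_norm flip: scaleR_diff_left)
  finally show "dist (f (x + s *\<^sub>R v)) (f (x + t *\<^sub>R v)) \<le> L * norm v * dist s t" by (simp add: mult.assoc)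
qed (use lipschitz_on_nonneg[OF assms] in simp)

lemma lipschitz_quotient_bound:
  fixes f :: "'a::real_normed_vector \<Rightarrow> real"
  assumes "L-lipschitz_on UNIV f"
  shows "\<bar>(f (x + h *\<^sub>R v) - f x) / h\<bar> \<le> L * norm v"
proof (cases "h = 0")
  case False
  have "\<bar>f (x + h *\<^sub>R v) - f x\<bar> \<le> L * norm v * \<bar>h\<bar>"
    using lipschitz_onD[OF lipschitz_on_line[OF assms, of v x], of h 0] by (simp add: dist_real_def)
  then show ?thesis using False by (simp add: abs_divide divide_le_eq)
qed (use lipschitz_on_nonneg[OF assms] in simp)

text \<open>Straddling at x + t v in direction v is straddling at t of the restriction to the line,
  so the one-dimensional result applies on every line.\<close>

lemma null_sets_straddle:
  fixes f :: "'a::euclidean_space \<Rightarrow> real"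
  assumes lip: "L-lipschitz_on UNIV f" and "p < q"
  shows "straddle f v p q \<in> null_sets lborel"
proof (rule null_sets_if_null_on_lines)
  show "straddle f v p q \<in> sets borel"
    by (rule borel_straddle[OF lipschitz_on_continuous_on[OF lip]])
  fix x
  have "{t. x + t *\<^sub>R v \<in> straddle f v p q} = straddle (\<lambda>t. f (x + t *\<^sub>R v)) 1 p q"
    by (auto simp: straddle_def scaleR_add_left add.assoc)
  then show "negligible {t. x + t *\<^sub>R v \<in> straddle f v p q}"
    using negligible_straddle_real[OF lipschitz_on_line[OF lip] \<open>p < q\<close>] by simp
qed

text \<open>Defined as a limit along a sequence so as to be measurable; meaningful only where the
  two-sided limit exists, which for a Lipschitz function is almost everywhere.\<close>

definition dirderiv :: "('a::euclidean_space \<Rightarrow> real) \<Rightarrow> 'a \<Rightarrow> 'a \<Rightarrow> real" where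
  "dirderiv f v x = lim (\<lambda>n. (f (x + (1 / real (Suc n)) *\<^sub>R v) - f x) / (1 / real (Suc n)))"

lemma filterlim_inverse_Suc: "filterlim (\<lambda>n. 1 / real (Suc n)) (at 0) sequentially"
  using LIMSEQ_Suc[OF lim_1_over_n] by (auto simp: filterlim_at)

lemma dirderiv_eqI:
  assumes "((\<lambda>h. (f (x + h *\<^sub>R v) - f x) / h) \<longlongrightarrow> l) (at 0)"
  shows "dirderiv f v x = l"
  unfolding dirderiv_def using filterlim_compose[OF assms filterlim_inverse_Suc] by (rule limI)

lemma borel_measurable_dirderiv [measurable]:
  fixes f :: "'a::euclidean_space \<Rightarrow> real"
  assumes [measurable]: "f \<in> borel_measurable borel"
  shows "dirderiv f v \<in> borel_measurable borel"
  unfolding dirderiv_def[abs_def] by measurable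

lemma AE_tendsto_dirderiv:
  fixes f :: "'a::euclidean_space \<Rightarrow> real"
  assumes lip: "L-lipschitz_on UNIV f"
  shows "AE x in lborel. ((\<lambda>h. (f (x + h *\<^sub>R v) - f x) / h) \<longlongrightarrow> dirderiv f v x) (at 0)"
proof -
  let ?P = "{(p, q). p \<in> \<rat> \<and> q \<in> \<rat> \<and> p < (q::real)}"
  have "countable ?P"
    by (rule countable_subset[of _ "\<rat> \<times> \<rat>"]) (auto simp: countable_rat)
  moreover have "AE x in lborel. x \<notin> straddle f v (fst i) (snd i)" if "i \<in> ?P" for i
    using that null_sets_straddle[OF lip, of "fst i" "snd i" v] by (auto intro!: AE_not_in)
  ultimately have "AE x in lborel. \<forall>i\<in>?P. x \<notin> straddle f v (fst i) (snd i)"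
    by (subst AE_ball_countable) auto
  then show ?thesis
  proof (rule AE_mp, intro AE_I2 impI)
    fix x assume x: "\<forall>i\<in>?P. x \<notin> straddle f v (fst i) (snd i)"
    have "\<exists>l. ((\<lambda>h. (f (x + h *\<^sub>R v) - f x) / h) \<longlongrightarrow> l) (at 0)"
      using x by (intro bounded_tendsto_if_not_straddling[OF lipschitz_quotient_bound[OF lip]])
        (auto simp: straddle_def)
    then show "((\<lambda>h. (f (x + h *\<^sub>R v) - f x) / h) \<longlongrightarrow> dirderiv f v x) (at 0)"
      using dirderiv_eqI by blast
  qed
qed


text \<open>The function 1 + g / (M + 1) is a nonnegative density whose measure agrees with Lebesgue
  measure on boxes, hence everywhere. Uniqueness of densities makes it 1 almost everywhere.\<close>

lemma AE_zero_if_box_integrals_zero: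
  fixes g :: "'a::euclidean_space \<Rightarrow> real"
  assumes [measurable]: "g \<in> borel_measurable borel" and bdd: "\<And>x. \<bar>g x\<bar> \<le> M"
    and zero: "\<And>a b. (\<integral>x. indicator (box a b) x * g x \<partial>lborel) = 0"
  shows "AE x in lborel. g x = 0"
proof -
  define h where "h x = 1 + g x / (M + 1)" for x
  have M: "0 \<le> M" using bdd[of 0] by linarith
  have h0: "0 \<le> h x" for x
    using bdd[of x] M by (auto simp: h_def field_simps)
  have [measurable]: "h \<in> borel_measurable borel" unfolding h_def by measurable
  have "lborel = density lborel h"
  proof (rule lborel_eqI)
    fix l u :: 'a assume lu: "\<And>b. b \<in> Basis \<Longrightarrow> l \<bullet> b \<le> u \<bullet> b"
    have i1: "integrable lborel (\<lambda>x. indicator (box l u) x :: real)"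
      using emeasure_bounded_finite[OF bounded_box] by (intro integrable_real_indicator) auto
    have i2: "integrable lborel (\<lambda>x. indicator (box l u) x * g x)"
      by (rule Bochner_Integration.integrable_bound[OF integrable_mult_right[OF i1, of M]])
        (use bdd M in \<open>auto simp: indicator_def abs_mult\<close>)
    have eq: "indicator (box l u) x * h x = indicator (box l u) x + indicator (box l u) x * g x / (M + 1)" for x
      by (simp add: h_def algebra_simps)
    have "emeasure (density lborel h) (box l u) = (\<integral>\<^sup>+x. ennreal (indicator (box l u) x * h x) \<partial>lborel)"
      by (subst emeasure_density) (auto intro!: nn_integral_cong simp: indicator_def)
    also have "\<dots> = ennreal (\<integral>x. indicator (box l u) x * h x \<partial>lborel)"
    proof (rule nn_integral_eq_integral)
      show "integrable lborel (\<lambda>x. indicator (box l u) x * h x)"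
        unfolding eq using i1 i2 by (intro Bochner_Integration.integrable_add integrable_divide_zero) auto
    qed (use h0 in simp)
    also have "(\<integral>x. indicator (box l u) x * h x \<partial>lborel) = measure lborel (box l u)"
      unfolding eq using i1 i2 zero by (subst Bochner_Integration.integral_add) auto
    finally show "emeasure (density lborel h) (box l u) = ennreal (\<Prod>b\<in>Basis. (u - l) \<bullet> b)"
      using lu by (simp add: measure_lborel_box_eq)
  qed simp
  then have "density lborel (\<lambda>x. ennreal (h x)) = density lborel (\<lambda>_. 1)"
    by (simp add: density_1)
  then have "AE x in lborel. ennreal (h x) = 1"
    by (intro sigma_finite_measure.density_unique[OF sigma_finite_lborel]) auto
  then show ?thesis
    by (rule AE_mp) (use M h0 in \<open>auto simp: h_def ennreal_eq_1\<close>)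
qed

text \<open>Writing the increment in direction \<open>e + w\<close> as that in direction \<open>e\<close> plus that in direction
  \<open>w\<close> at a translated point, the defect of additivity is a limit of differences of translates,
  whose integral over any box tends to 0.\<close>

lemma AE_dirderiv_add:
  fixes f :: "'a::euclidean_space \<Rightarrow> real"
  assumes lip: "L-lipschitz_on UNIV f"
  shows "AE x in lborel. dirderiv f (e + w) x = dirderiv f e x + dirderiv f w x"
proof -
  let ?Q = "\<lambda>v h x. (f (x + h *\<^sub>R v) - f x) / h"
  let ?h = "\<lambda>n. 1 / real (Suc n)"
  have [measurable]: "f \<in> borel_measurable borel"
    by (intro borel_measurable_continuous_onI lipschitz_on_continuous_on[OF lip])
  have QL: "\<bar>?Q v h x\<bar> \<le> L * norm v" for v h x by (rule lipschitz_quotient_bound[OF lip])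
  define g0 where "g0 x = dirderiv f (e + w) x - dirderiv f e x - dirderiv f w x" for x
  define M where "M = 2 * (L * norm w)"
  \<comment> \<open>The defect \<open>g0\<close> satisfies the bound \<open>M\<close> only where the
    limits exist. Clamping makes the bound hold everywhere, as the box criterion demands.\<close>
  define g where "g x = max (- M) (min M (g0 x))" for x
  have L0: "0 \<le> L" using lip by (rule lipschitz_on_nonneg)
  have M0: "0 \<le> M" using L0 by (simp add: M_def)
  define d where "d n x = ?Q w (?h n) (x + ?h n *\<^sub>R e) - ?Q w (?h n) x" for n x
  have dM: "\<bar>d n x\<bar> \<le> M" for n x
    using QL[where v=w and h="?h n" and x=x] QL[where v=w and h="?h n" and x="x + ?h n *\<^sub>R e"]
    unfolding d_def M_def by linarith
  have lim: "AE x in lborel. (\<lambda>n. d n x) \<longlonglongrightarrow> g x \<and> g x = g0 x"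
    using AE_tendsto_dirderiv[OF lip, of "e + w"] AE_tendsto_dirderiv[OF lip, of e]
      AE_tendsto_dirderiv[OF lip, of w]
  proof eventually_elim
    case (elim x)
    have "d n x = ?Q (e + w) (?h n) x - ?Q e (?h n) x - ?Q w (?h n) x" for n
      by (simp add: d_def scaleR_add_right add.assoc diff_divide_distrib algebra_simps)
    moreover have "(\<lambda>n. ?Q (e + w) (?h n) x - ?Q e (?h n) x - ?Q w (?h n) x) \<longlonglongrightarrow> g0 x"
      unfolding g0_def
      by (intro tendsto_diff filterlim_compose[OF elim(1) filterlim_inverse_Suc]
        filterlim_compose[OF elim(2) filterlim_inverse_Suc]
        filterlim_compose[OF elim(3) filterlim_inverse_Suc])
    ultimately have l: "(\<lambda>n. d n x) \<longlonglongrightarrow> g0 x" by simp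
    have "\<bar>g0 x\<bar> \<le> M"
      by (rule tendsto_upperbound[OF tendsto_rabs[OF l]]) (use dM in auto)
    then have "g x = g0 x" by (auto simp: g_def)
    with l show ?case by simp
  qed
  have [measurable]: "g0 \<in> borel_measurable borel" unfolding g0_def by measurable
  have [measurable]: "g \<in> borel_measurable borel" unfolding g_def by measurable
  have [measurable]: "d n \<in> borel_measurable borel" for n unfolding d_def by measurable
  have "AE x in lborel. g x = 0"
  proof (rule AE_zero_if_box_integrals_zero)
    show "\<bar>g x\<bar> \<le> M" for x using M0 by (auto simp: g_def)
    fix a b :: 'a
    let ?B = "box a b"
    have iB: "integrable lborel (\<lambda>x. indicator A x * c :: real)" if "A \<in> sets borel" "bounded A" for A :: "'a set" and c
      using that emeasure_bounded_finite[of A] by (intro integrable_mult_left integrable_real_indicator) auto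
    have L1: "(\<lambda>n. \<integral>x. indicator ?B x * d n x \<partial>lborel) \<longlonglongrightarrow> (\<integral>x. indicator ?B x * g x \<partial>lborel)"
    proof (rule integral_dominated_convergence[where w = "\<lambda>x. indicator ?B x * M"])
      show "AE x in lborel. (\<lambda>n. indicator ?B x * d n x) \<longlonglongrightarrow> indicator ?B x * g x"
        using lim by (auto intro!: tendsto_intros elim: AE_mp)
      show "AE x in lborel. norm (indicator ?B x * d n x) \<le> indicator ?B x * M" for n
        using dM by (auto simp: indicator_def)
      show "integrable lborel (\<lambda>x. indicator ?B x * M)" by (rule iB) auto
    qed measurable
    obtain r where r: "?B \<subseteq> ball 0 r" "0 < r"
      using bounded_subset_ballD[OF bounded_box] by blast
    \<comment> \<open>This ball contains the box and all its translates by
      \<open>?h n *\<^sub>R e\<close>, because the steps are at most 1; it supports a common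
      dominating function.\<close>
    let ?C = "ball (0::'a) (r + norm e)"
    \<comment> \<open>The translation is moved from the quotient to the indicator of the box, so
      convergence of the quotients is no longer needed.\<close>
    have shift: "(\<integral>x. indicator ?B x * d n x \<partial>lborel) =
        (\<integral>x. (indicator ?B (x - ?h n *\<^sub>R e) - indicator ?B x) * ?Q w (?h n) x \<partial>lborel)" for n
    proof -
      let ?q = "?Q w (?h n)"
      have [measurable]: "?q \<in> borel_measurable borel" by measurable
      have int: "integrable lborel (\<lambda>x. indicator A x * ?q (x + c))" if "A \<in> sets borel" "bounded A" for A c
      proof (rule Bochner_Integration.integrable_bound[OF iB[OF that, of "L * norm w"]])
        show "AE x in lborel. norm (indicator A x * ?q (x + c)) \<le> norm (indicator A x * (L * norm w))"
          unfolding real_norm_def abs_mult[of "indicator A _"]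
          by (intro AE_I2 mult_left_mono order_trans[OF QL abs_ge_self]) auto
      qed (use that(1) in measurable)
      have "(\<integral>x. indicator ?B x * ?q (x + ?h n *\<^sub>R e) \<partial>lborel)
          = (\<integral>x. indicator ?B (x - ?h n *\<^sub>R e) * ?q x \<partial>distr lborel borel ((+) (?h n *\<^sub>R e)))"
        by (subst integral_distr) (auto simp: add.commute)
      also have "\<dots> = (\<integral>x. indicator ?B (x - ?h n *\<^sub>R e) * ?q x \<partial>lborel)"
        by (simp only: lborel_distr_plus)
      finally have 1: "(\<integral>x. indicator ?B x * ?q (x + ?h n *\<^sub>R e) \<partial>lborel)
          = (\<integral>x. indicator ?B (x - ?h n *\<^sub>R e) * ?q x \<partial>lborel)" .
      have "indicator ?B (x - ?h n *\<^sub>R e) = (indicator ((+) (?h n *\<^sub>R e) ` ?B) x :: real)" for x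
        by (auto simp: indicator_def image_iff algebra_simps)
      moreover have "(+) (?h n *\<^sub>R e) ` ?B \<in> sets borel"
        by (intro borel_open open_translation) auto
      moreover have "bounded ((+) (?h n *\<^sub>R e) ` ?B)"
        by (intro bounded_translation) auto
      ultimately have 2: "integrable lborel (\<lambda>x. indicator ?B (x - ?h n *\<^sub>R e) * ?q x)"
        using int[of _ 0] by simp
      have "(\<integral>x. indicator ?B x * d n x \<partial>lborel)
          = (\<integral>x. indicator ?B x * ?q (x + ?h n *\<^sub>R e) - indicator ?B x * ?q x \<partial>lborel)"
        by (simp add: d_def algebra_simps)
      also have "\<dots> = (\<integral>x. indicator ?B x * ?q (x + ?h n *\<^sub>R e) \<partial>lborel) - (\<integral>x. indicator ?B x * ?q x \<partial>lborel)"
        using int[of ?B "?h n *\<^sub>R e"] int[of ?B 0] by (intro Bochner_Integration.integral_diff) auto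
      also have "\<dots> = (\<integral>x. indicator ?B (x - ?h n *\<^sub>R e) * ?q x - indicator ?B x * ?q x \<partial>lborel)"
        unfolding 1 using 2 int[of ?B 0] by (intro Bochner_Integration.integral_diff[symmetric]) auto
      finally show ?thesis by (simp add: algebra_simps)
    qed
    have L2: "(\<lambda>n. \<integral>x. indicator ?B x * d n x \<partial>lborel) \<longlonglongrightarrow> (\<integral>x. 0 \<partial>(lborel :: 'a measure))"
      unfolding shift
    proof (rule integral_dominated_convergence[where w = "\<lambda>x. indicator ?C x * (L * norm w)"])
      \<comment> \<open>Off the boundary of the box, which is null, the two indicators eventually
        agree and the integrand is eventually 0.\<close>
      have "frontier ?B \<in> null_sets lborel"
        using negligible_convex_frontier[OF convex_box(2)[of a b]]
        by (simp add: negligible_iff_null_sets null_sets_completion_iff borel_closed)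
      then have "AE x in lborel. x \<notin> frontier ?B" by (rule AE_not_in)
      then show "AE x in lborel. (\<lambda>n. (indicator ?B (x - ?h n *\<^sub>R e) - indicator ?B x) * ?Q w (?h n) x) \<longlonglongrightarrow> 0"
      proof (rule AE_mp, intro AE_I2 impI)
        fix x :: 'a assume x: "x \<notin> frontier ?B"
        have "(\<lambda>n. x - ?h n *\<^sub>R e) \<longlonglongrightarrow> x - 0 *\<^sub>R e"
          using LIMSEQ_Suc[OF lim_1_over_n] by (intro tendsto_intros)
        then have lx: "(\<lambda>n. x - ?h n *\<^sub>R e) \<longlonglongrightarrow> x" by simp
        have "\<forall>\<^sub>F n in sequentially. indicator ?B (x - ?h n *\<^sub>R e) = (indicator ?B x :: real)"
        proof (cases "x \<in> ?B")
          case True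
          then have "\<forall>\<^sub>F n in sequentially. x - ?h n *\<^sub>R e \<in> ?B"
            using topological_tendstoD[OF lx open_box] by blast
          then show ?thesis using True by (auto elim: eventually_mono)
        next
          case False
          then have "x \<in> - closure ?B" using x interior_open[OF open_box, of a b] by (auto simp: frontier_def)
          then have "\<forall>\<^sub>F n in sequentially. x - ?h n *\<^sub>R e \<in> - closure ?B"
            using topological_tendstoD[OF lx, of "- closure ?B"] by auto
          then show ?thesis using False closure_subset[of ?B] by (auto elim!: eventually_mono simp: indicator_def)
        qed
        then show "(\<lambda>n. (indicator ?B (x - ?h n *\<^sub>R e) - indicator ?B x) * ?Q w (?h n) x) \<longlonglongrightarrow> 0"
          by (intro tendsto_eventually) (auto elim: eventually_mono)
      qed
      show "AE x in lborel. norm ((indicator ?B (x - ?h n *\<^sub>R e) - indicator ?B x) * ?Q w (?h n) x)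
          \<le> indicator ?C x * (L * norm w)" for n
      proof (intro AE_I2)
        fix x :: 'a
        have sm: "norm (?h n *\<^sub>R e) \<le> norm e" by (simp add: divide_le_eq mult_le_cancel_left1 algebra_simps)
        have "\<bar>indicator ?B (x - ?h n *\<^sub>R e) - indicator ?B x\<bar> \<le> (indicator ?C x :: real)"
        proof (cases "x \<in> ?C")
          case False
          then have "\<not> norm x < r + norm e" by simp
          then have "x \<notin> ball 0 r" "x - ?h n *\<^sub>R e \<notin> ball 0 r"
            using norm_triangle_ineq2[of x "?h n *\<^sub>R e"] sm norm_ge_zero[of e]
            unfolding mem_ball dist_0_norm by (linarith+)
          then show ?thesis using r(1) by (auto simp: indicator_def)
        qed (auto simp: indicator_def)
        then show "norm ((indicator ?B (x - ?h n *\<^sub>R e) - indicator ?B x) * ?Q w (?h n) x)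
          \<le> indicator ?C x * (L * norm w)"
          unfolding real_norm_def abs_mult by (rule mult_mono[OF _ QL]) auto
      qed
      show "integrable lborel (\<lambda>x. indicator ?C x * (L * norm w))" by (rule iB) auto
    qed measurable
    show "(\<integral>x. indicator ?B x * g x \<partial>lborel) = 0"
      using LIMSEQ_unique[OF L1 L2] by simp
  qed measurable
  with lim show ?thesis by eventually_elim (simp add: g0_def)
qed


section \<open>From directional derivatives to total differentiability\<close>

lemma tendsto_quotient_scaleR:
  fixes f :: "'a::real_normed_vector \<Rightarrow> real"
  assumes "((\<lambda>h. (f (x + h *\<^sub>R v) - f x) / h) \<longlongrightarrow> l) (at 0)"
  shows "((\<lambda>h. (f (x + h *\<^sub>R (c *\<^sub>R v)) - f x) / h) \<longlongrightarrow> c * l) (at 0)"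
proof (cases "c = 0")
  case False
  have "filterlim (\<lambda>h. h * c) (at 0) (at 0)"
    unfolding filterlim_at using False by (auto simp: eventually_at_filter intro!: tendsto_eq_intros)
  from tendsto_mult[OF tendsto_const[of c] filterlim_compose[OF assms this]]
  show ?thesis
    by (rule Lim_transform_eventually) (use False in \<open>auto simp: eventually_at_filter\<close>)
qed simp

lemma AE_dirderiv_sum:
  fixes f :: "'a::euclidean_space \<Rightarrow> real"
  assumes lip: "L-lipschitz_on UNIV f"
  shows "AE x in lborel. dirderiv f w x = (\<Sum>b\<in>Basis. (w \<bullet> b) * dirderiv f b x)"
proof -
  have "AE x in lborel. dirderiv f (\<Sum>b\<in>B. (w \<bullet> b) *\<^sub>R b) x = (\<Sum>b\<in>B. (w \<bullet> b) * dirderiv f b x)"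
    if "finite B" for B
    using that
  proof induction
    case empty
    have "dirderiv f 0 x = 0" for x by (rule dirderiv_eqI) simp
    then show ?case by simp
  next
    case (insert b B)
    have "AE x in lborel. dirderiv f ((w \<bullet> b) *\<^sub>R b) x = (w \<bullet> b) * dirderiv f b x"
      using AE_tendsto_dirderiv[OF lip, of b]
      by eventually_elim (intro dirderiv_eqI tendsto_quotient_scaleR)
    then show ?case
      using insert.IH AE_dirderiv_add[OF lip, of "(w \<bullet> b) *\<^sub>R b" "\<Sum>b\<in>B. (w \<bullet> b) *\<^sub>R b"]
      by eventually_elim (use insert.hyps in simp)
  qed
  from this[OF finite_Basis] show ?thesis by (simp add: euclidean_representation)
qed

text \<open>Compactness of the unit sphere gives a finite net of good directions, on which the
  convergence is uniform. The Lipschitz bounds on \<open>f\<close> and \<open>D\<close> carry the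
  estimate to all directions.\<close>

lemma has_derivative_if_dense_directions:
  fixes f :: "'a::euclidean_space \<Rightarrow> real"
  assumes lip: "L-lipschitz_on UNIV f" and D: "bounded_linear D"
    and dense: "\<And>X. open X \<Longrightarrow> X \<noteq> {} \<Longrightarrow> \<exists>w\<in>Q. w \<in> X"
    and dir: "\<And>w. w \<in> Q \<Longrightarrow> ((\<lambda>h. (f (x + h *\<^sub>R w) - f x) / h) \<longlongrightarrow> D w) (at 0)"
  shows "(f has_derivative D) (at x)"
proof -
  interpret D: bounded_linear D by fact
  have L0: "0 \<le> L" using lip by (rule lipschitz_on_nonneg)
  obtain K where K: "0 < K" "\<And>v. norm (D v) \<le> norm v * K" using D.pos_bounded by blast
  have "\<exists>d>0. \<forall>y. norm (y - x) < d \<longrightarrow> norm (f y - f x - D (y - x)) \<le> e * norm (y - x)" if e: "e > 0" for e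
  proof -
    \<comment> \<open>Replacing a unit direction by a net point costs \<open>L * r\<close> in
      \<open>f\<close> and \<open>K * r\<close> in \<open>D\<close>; together this is half of
      \<open>e\<close>.\<close>
    define r where "r = e / (2 * (L + K))"
    have r: "0 < r" "(L + K) * r = e / 2" using e K L0 by (auto simp: r_def field_simps add_nonneg_pos)
    have "sphere 0 1 \<subseteq> (\<Union>w\<in>Q. ball w r)"
    proof
      fix u :: 'a
      have "\<exists>w\<in>Q. w \<in> ball u r" by (rule dense) (use r in auto)
      then show "u \<in> (\<Union>w\<in>Q. ball w r)" by (auto simp: dist_commute)
    qed
    then obtain F where F: "F \<subseteq> Q" "finite F" "sphere 0 1 \<subseteq> (\<Union>w\<in>F. ball w r)"
      using compactE_image[OF compact_sphere, of Q "\<lambda>w. ball w r"] by (metis open_ball)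
    have "\<forall>\<^sub>F h in at 0. \<forall>w\<in>F. \<bar>(f (x + h *\<^sub>R w) - f x) / h - D w\<bar> < e / 2"
      using tendstoD[OF dir, of _ "e / 2"] F(1) e
      by (intro eventually_ball_finite F(2)) (auto simp: dist_real_def)
    then obtain d where d: "d > 0" "\<And>h w. h \<noteq> 0 \<Longrightarrow> \<bar>h\<bar> < d \<Longrightarrow> w \<in> F \<Longrightarrow>
        \<bar>(f (x + h *\<^sub>R w) - f x) / h - D w\<bar> < e / 2"
      by (auto simp: eventually_at dist_real_def)
    have "norm (f y - f x - D (y - x)) \<le> e * norm (y - x)" if y: "norm (y - x) < d" for y
    proof (cases "y = x")
      case False
      define h where "h = norm (y - x)"
      define u where "u = (1 / h) *\<^sub>R (y - x)"
      have h: "h > 0" "h < d" using False y by (auto simp: h_def)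
      have yx: "y = x + h *\<^sub>R u" using h by (simp add: u_def)
      have "u \<in> sphere 0 1" using h by (simp add: u_def h_def)
      then obtain w where w: "w \<in> F" "norm (u - w) < r"
        using F(3) by (auto simp: dist_norm norm_minus_commute)
      have "\<bar>(f (x + h *\<^sub>R w) - f x) / h - D w\<bar> * h \<le> e / 2 * h"
        using d(2)[OF _ _ w(1), of h] h by (intro mult_right_mono) auto
      moreover have "\<bar>(f (x + h *\<^sub>R w) - f x) / h - D w\<bar> * h = \<bar>((f (x + h *\<^sub>R w) - f x) / h - D w) * h\<bar>"
        using h by (simp add: abs_mult)
      moreover have "((f (x + h *\<^sub>R w) - f x) / h - D w) * h = f (x + h *\<^sub>R w) - f x - h * D w"
        using h by (simp add: field_simps)
      ultimately have 1: "\<bar>f (x + h *\<^sub>R w) - f x - h * D w\<bar> \<le> e / 2 * h" by simp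
      have 2: "\<bar>f y - f (x + h *\<^sub>R w)\<bar> \<le> L * (h * norm (u - w))"
        using lipschitz_onD[OF lip, of y "x + h *\<^sub>R w"] h
        by (simp add: yx dist_norm flip: scaleR_diff_right)
      have "D (y - x) - h * D w = D (h *\<^sub>R (u - w))" by (simp add: yx D.scaleR D.diff D.add algebra_simps)
      then have 3: "\<bar>D (y - x) - h * D w\<bar> \<le> K * (h * norm (u - w))"
        using K(2)[of "h *\<^sub>R (u - w)"] h by (simp add: mult_ac)
      have "norm (f y - f x - D (y - x)) \<le> e / 2 * h + (L + K) * (h * norm (u - w))"
        using 1 2 3 unfolding real_norm_def distrib_right by linarith
      also have "\<dots> \<le> e / 2 * h + (L + K) * (h * r)"
        using w h L0 K by (intro add_left_mono mult_left_mono) auto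
      also have "\<dots> = e / 2 * h + ((L + K) * r) * h" by (simp add: mult_ac)
      also have "\<dots> = e * h" unfolding r(2) by (simp add: field_simps)
      finally show ?thesis by (simp add: h_def)
    qed (simp add: D.zero)
    with d(1) show ?thesis by blast
  qed
  then show ?thesis using D by (simp add: has_derivative_at_alt)
qed

text \<open>Linearity of the directional derivative in w holds off a null set that depends on w.
  Restricting to a countable dense set of directions keeps the exceptional set null, and dense
  directions suffice.\<close>

theorem rademacher:
  fixes f :: "'a::euclidean_space \<Rightarrow> real"
  assumes lip: "L-lipschitz_on UNIV f"
  shows "AE x in lborel. f differentiable at x"
proof -
  obtain Q :: "'a set" where Q: "countable Q" "\<And>X. open X \<Longrightarrow> X \<noteq> {} \<Longrightarrow> \<exists>w\<in>Q. w \<in> X"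
    using countable_dense_exists by blast
  have "AE x in lborel. \<forall>w\<in>Q. ((\<lambda>h. (f (x + h *\<^sub>R w) - f x) / h) \<longlongrightarrow> dirderiv f w x) (at 0)
      \<and> dirderiv f w x = (\<Sum>b\<in>Basis. (w \<bullet> b) * dirderiv f b x)"
    using AE_tendsto_dirderiv[OF lip] AE_dirderiv_sum[OF lip] Q(1) by (subst AE_ball_countable) auto
  then show ?thesis
  proof (rule AE_mp, intro AE_I2 impI)
    fix x assume x: "\<forall>w\<in>Q. ((\<lambda>h. (f (x + h *\<^sub>R w) - f x) / h) \<longlongrightarrow> dirderiv f w x) (at 0)
      \<and> dirderiv f w x = (\<Sum>b\<in>Basis. (w \<bullet> b) * dirderiv f b x)"
    have "bounded_linear (\<lambda>w. \<Sum>b\<in>Basis. (w \<bullet> b) * dirderiv f b x)"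
      by (intro bounded_linear_sum bounded_linear_mult_const bounded_linear_inner_left)
    then have "(f has_derivative (\<lambda>w. \<Sum>b\<in>Basis. (w \<bullet> b) * dirderiv f b x)) (at x)"
      by (rule has_derivative_if_dense_directions[OF lip _ Q(2)]) (use x in auto)
    then show "f differentiable at x" unfolding differentiable_def by blast
  qed
qed

text \<open>After adding a linear term the function increases strictly, so its increment is the
  length of the image of \<open>{0..T}\<close>. Off \<open>N\<close> the covering estimate bounds
  the image; the image of \<open>N\<close> is null.\<close>

lemma increment_le_real:
  fixes f :: "real \<Rightarrow> real"
  assumes lip: "L-lipschitz_on UNIV f" and "0 \<le> T" and N: "negligible N"
    and deriv: "\<And>t. t \<in> {0..T} - N \<Longrightarrow> \<exists>l\<le>c. (f has_real_derivative l) (at t)"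
  shows "f T - f 0 \<le> c * T"
proof (rule field_le_epsilon)
  fix e :: real assume e: "0 < e"
  \<comment> \<open>The excess over \<open>L\<close> makes \<open>g\<close> strictly increasing and
    also gives c + M \<ge> 1, so the slope bound \<open>p\<close> is positive.\<close>
  define M where "M = L + \<bar>c\<bar> + 1"
  define g where "g x = f x + M * x" for x
  have L0: "0 \<le> L" using lip by (rule lipschitz_on_nonneg)
  have fL: "\<bar>f x - f y\<bar> \<le> L * \<bar>x - y\<bar>" for x y
    using lipschitz_onD[OF lip, of x y] by (simp add: dist_real_def)
  have glip: "(L + M)-lipschitz_on UNIV g" unfolding g_def using L0
    by (intro lipschitz_on_add lip lipschitz_on_cmult_real_nonneg[of 1 _ _ M, simplified] lipschitz_on_id) (auto simp: M_def)
  have mono: "strict_mono g"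
  proof (rule strict_monoI)
    fix x y :: real assume "x < y"
    then have "0 < (\<bar>c\<bar> + 1) * (y - x)" by (intro mult_pos_pos) auto
    then show "g x < g y" using fL[of y x] \<open>x < y\<close> by (simp add: g_def M_def algebra_simps)
  qed
  \<comment> \<open>The slack \<open>d\<close> in the slope and \<open>d / p\<close> in the measure
    of \<open>U\<close> add up to \<open>d * (T + 1)\<close>, which is at most
    \<open>e\<close>.\<close>
  define d where "d = e / (T + c + M + 2)"
  define p where "p = c + M + d"
  have cM: "1 \<le> c + M" using L0 by (simp add: M_def)
  have d: "0 < d" using e cM \<open>0 \<le> T\<close> by (simp add: d_def)
  have p: "0 < p" using d cM by (simp add: p_def)
  obtain U where U: "open U" "{0..T} \<subseteq> U" "emeasure lebesgue U \<le> emeasure lebesgue {0..T} + ennreal (d / p)"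
    using open_superset_emeasure_le[of "{0..T}" "d / p"] d p by auto
  have "\<exists>S\<in>sets lebesgue. g ` ({0..T} - N) \<subseteq> S \<and> emeasure lebesgue S \<le> ennreal p * emeasure lebesgue U"
  proof (rule emeasure_image_le_slope[OF mono glip U(1)])
    fix t s :: real assume t: "t \<in> {0..T} - N" and s: "0 < s"
    obtain l where l: "l \<le> c" "(f has_real_derivative l) (at t)" using deriv[OF t] by blast
    have "(g has_real_derivative (l + M)) (at t)"
      unfolding g_def using l(2) by (auto intro!: derivative_eq_intros)
    then have "((\<lambda>h. (g (t + h) - g t) / h) \<longlongrightarrow> l + M) (at 0)" by (simp add: DERIV_def)
    then have "\<forall>\<^sub>F h in at 0. (g (t + h) - g t) / h < p"
      by (rule order_tendstoD) (use l d in \<open>simp add: p_def\<close>)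
    then obtain k where k: "k > 0" "\<And>h. h \<noteq> 0 \<Longrightarrow> \<bar>h\<bar> < k \<Longrightarrow> (g (t + h) - g t) / h < p"
      by (auto simp: eventually_at dist_real_def)
    show "\<exists>h. h \<noteq> 0 \<and> \<bar>h\<bar> < s \<and> (g (t + h) - g t) / h \<le> p"
      using less_imp_le[OF k(2)[of "min k s / 2"]] k(1) s by (intro exI[of _ "min k s / 2"]) auto
  qed (use U p in auto)
  then obtain S where S: "S \<in> sets lebesgue" "g ` ({0..T} - N) \<subseteq> S"
    "emeasure lebesgue S \<le> ennreal p * emeasure lebesgue U" by blast
  have gN: "g ` N \<in> null_sets lebesgue"
    using lipschitz_image_negligible[OF glip N] by (simp add: negligible_iff_null_sets)
  have "{g 0..g T} \<subseteq> g ` {0..T}"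
  proof
    fix y assume "y \<in> {g 0..g T}"
    then have "\<exists>x\<ge>0. x \<le> T \<and> g x = y"
      using \<open>0 \<le> T\<close> by (intro IVT' continuous_on_subset[OF lipschitz_on_continuous_on[OF glip]]) auto
    then show "y \<in> g ` {0..T}" by auto
  qed
  also have "\<dots> \<subseteq> S \<union> g ` N" using S(2) by blast
  finally have "emeasure lebesgue {g 0..g T} \<le> emeasure lebesgue (S \<union> g ` N)"
    using S(1) gN by (intro emeasure_mono) auto
  also have "\<dots> = emeasure lebesgue S" by (rule emeasure_Un_null_set[OF S(1) gN])
  also have "\<dots> \<le> ennreal p * (ennreal T + ennreal (d / p))"
    using \<open>0 \<le> T\<close> U(3) by (intro order_trans[OF S(3)] mult_left_mono) auto
  also have "\<dots> = ennreal (p * (T + d / p))"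
    using p d \<open>0 \<le> T\<close> by (simp add: ennreal_plus[symmetric] ennreal_mult[symmetric] del: ennreal_plus)
  finally have "g T - g 0 \<le> p * (T + d / p)"
    using p d \<open>0 \<le> T\<close> mono by (simp add: strict_mono_less_eq ennreal_le_iff)
  also have "\<dots> = (c + M) * T + d * (T + 1)" using p by (simp add: p_def field_simps)
  also have "d * (T + 1) \<le> e"
    using e cM \<open>0 \<le> T\<close> by (simp add: d_def divide_le_eq)
  finally show "f T - f 0 \<le> c * T + e" by (simp add: g_def algebra_simps)
qed


section \<open>Increments of Lipschitz functions\<close>

lemma has_real_derivative_line:
  fixes f :: "'a::real_normed_vector \<Rightarrow> real"
  assumes D: "(f has_derivative D) (at (x + t *\<^sub>R v))"
  shows "((\<lambda>t. f (x + t *\<^sub>R v)) has_real_derivative D v) (at t)"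
proof -
  have "((\<lambda>t. x + t *\<^sub>R v) has_derivative (\<lambda>s. s *\<^sub>R v)) (at t)"
    by (auto intro!: derivative_eq_intros)
  from has_derivative_compose[OF this, of f D] D
  have "((\<lambda>t. f (x + t *\<^sub>R v)) has_derivative (\<lambda>s. D (s *\<^sub>R v))) (at t)" by simp
  moreover have "D (s *\<^sub>R v) = D v * s" for s
    using has_derivative_linear[OF D] by (simp add: linear_cmul)
  ultimately show ?thesis by (simp add: has_field_derivative_def)
qed

lemma lipschitz_derivative_bound:
  fixes f :: "'a::euclidean_space \<Rightarrow> real"
  assumes lip: "L-lipschitz_on U f" "open U" "x \<in> U" and D: "(f has_derivative D) (at x)"
  shows "\<bar>D v\<bar> \<le> L * norm v"
proof -
  have lim: "((\<lambda>h. (f (x + h *\<^sub>R v) - f x) / h) \<longlongrightarrow> D v) (at 0)"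
    using has_real_derivative_line[of f D x 0 v] D by (simp add: DERIV_def)
  have "((\<lambda>h. x + h *\<^sub>R v) \<longlongrightarrow> x + 0 *\<^sub>R v) (at 0)" by (intro tendsto_intros)
  then have "\<forall>\<^sub>F h in at 0. x + h *\<^sub>R v \<in> U"
    using topological_tendstoD[of _ x "at 0" U] lip by simp
  then have "\<forall>\<^sub>F h in at 0. \<bar>(f (x + h *\<^sub>R v) - f x) / h\<bar> \<le> L * norm v"
  proof (rule eventually_mono)
    fix h assume h: "x + h *\<^sub>R v \<in> U"
    have "\<bar>f (x + h *\<^sub>R v) - f x\<bar> \<le> L * (\<bar>h\<bar> * norm v)"
      using lipschitz_onD[OF lip(1) h lip(3)] by (simp add: dist_norm)
    then show "\<bar>(f (x + h *\<^sub>R v) - f x) / h\<bar> \<le> L * norm v"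
      using lipschitz_on_nonneg[OF lip(1)] by (cases "h = 0") (auto simp: abs_divide divide_le_eq mult_ac)
  qed
  then show ?thesis
    by (rule tendsto_upperbound[OF tendsto_rabs[OF lim]]) simp
qed

text \<open>By Rademacher's theorem and Fubini, along almost every line in direction \<open>v\<close> almost every
  point is a point of differentiability; the remaining lines follow by continuity.\<close>

lemma increment_le_if_derivatives_le_UNIV:
  fixes f :: "'a::euclidean_space \<Rightarrow> real"
  assumes lip: "L-lipschitz_on UNIV f" and U: "open U" and T: "0 \<le> T"
    and seg: "\<And>t. t \<in> {0..T} \<Longrightarrow> x + t *\<^sub>R v \<in> U"
    and deriv: "\<And>y D. y \<in> U \<Longrightarrow> (f has_derivative D) (at y) \<Longrightarrow> D v \<le> c"
  shows "f (x + T *\<^sub>R v) - f x \<le> c * T"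
proof -
  obtain N where N: "\<And>y. y \<in> space lborel - N \<Longrightarrow> f differentiable at y" "N \<in> null_sets lborel"
    using AE_E3[OF rademacher[OF lip]] by blast
  \<comment> \<open>A tube around the compact segment stays in \<open>U\<close>, so the derivative
    bound is available along all parallel segments starting in \<open>ball x r\<close>.\<close>
  let ?K = "(\<lambda>t. x + t *\<^sub>R v) ` {0..T}"
  have "compact ?K" by (intro compact_continuous_image continuous_intros) auto
  moreover have "?K \<subseteq> U" using seg by auto
  ultimately obtain r where r: "r > 0" "(\<Union>y\<in>?K. ball y r) \<subseteq> U"
    using compact_subset_open_imp_ball_epsilon_subset[OF _ U] by metis
  have ae: "AE y in lborel. y \<in> ball x r \<longrightarrow> f (y + T *\<^sub>R v) - f y \<le> c * T"
    using AE_lines_avoid_null_set[OF N(2) T, of v]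
  proof eventually_elim
    case (elim y)
    show ?case
    proof
      assume y: "y \<in> ball x r"
      have "f (y + T *\<^sub>R v) - f (y + 0 *\<^sub>R v) \<le> c * T"
      proof (rule increment_le_real[OF lipschitz_on_line[OF lip] T elim])
        fix t assume t: "t \<in> {0..T} - {t \<in> {0..T}. y + t *\<^sub>R v \<in> N}"
        then have "f differentiable at (y + t *\<^sub>R v)" using N(1) by auto
        then obtain D where D: "(f has_derivative D) (at (y + t *\<^sub>R v))" by (auto simp: differentiable_def)
        have "y + t *\<^sub>R v \<in> ball (x + t *\<^sub>R v) r" using y by (simp add: dist_norm)
        then have "y + t *\<^sub>R v \<in> U" using t r(2) by blast
        then have "D v \<le> c" using deriv D by blast
        then show "\<exists>l\<le>c. ((\<lambda>t. f (y + t *\<^sub>R v)) has_real_derivative l) (at t)"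
          using has_real_derivative_line[OF D] by blast
      qed
      then show "f (y + T *\<^sub>R v) - f y \<le> c * T" by simp
    qed
  qed
  \<comment> \<open>The set of bad starting points is open by continuity and null by the preceding
    estimate, hence empty.\<close>
  let ?B = "{y \<in> ball x r. c * T < f (y + T *\<^sub>R v) - f y}"
  have cf: "continuous_on UNIV f" by (rule lipschitz_on_continuous_on[OF lip])
  have "?B = ball x r \<inter> {y. c * T < f (y + T *\<^sub>R v) - f y}" by auto
  then have "open ?B"
    by (auto intro!: open_Int open_Collect_less continuous_intros continuous_on_compose2[OF cf])
  moreover have "negligible ?B"
  proof -
    have "?B \<in> null_sets lborel"
    proof (rule AE_iff_null_sets[THEN iffD2])
      show "AE y in lborel. y \<notin> ?B"
        using ae by eventually_elim auto
    qed (use \<open>open ?B\<close> in simp)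
    then show ?thesis by (simp add: negligible_iff_null_sets null_sets_completionI)
  qed
  ultimately have "?B = {}" using open_not_negligible by blast
  then have "x \<notin> {y \<in> ball x r. c * T < f (y + T *\<^sub>R v) - f y}" by blast
  then show ?thesis using r by simp
qed

text \<open>Composition with the nearest point projection onto the ball extends \<open>f\<close> to
  a globally Lipschitz function with the same constant; inside the open ball values and derivatives
  are unchanged.\<close>

lemma increment_le_if_derivatives_le:
  fixes f :: "'a::euclidean_space \<Rightarrow> real"
  assumes lip: "L-lipschitz_on (cball z r) f" and T: "0 \<le> T"
    and seg: "\<And>t. t \<in> {0..T} \<Longrightarrow> x + t *\<^sub>R v \<in> ball z r"
    and deriv: "\<And>y D. y \<in> ball z r \<Longrightarrow> (f has_derivative D) (at y) \<Longrightarrow> D v \<le> c"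
  shows "f (x + T *\<^sub>R v) - f x \<le> c * T"
proof -
  define g where "g = f \<circ> closest_point (cball z r)"
  have ne: "cball z r \<noteq> {}" using seg[of 0] T by (auto dest: le_less_trans[OF zero_le_dist])
  have in_cball: "closest_point (cball z r) y \<in> cball z r" for y
    by (rule closest_point_in_set[OF closed_cball ne])
  have "L-lipschitz_on UNIV g"
  proof (rule lipschitz_onI)
    show L: "0 \<le> L" using lip by (rule lipschitz_on_nonneg)
    fix a b
    have "dist (g a) (g b) \<le> L * dist (closest_point (cball z r) a) (closest_point (cball z r) b)"
      unfolding g_def comp_def by (rule lipschitz_onD[OF lip in_cball in_cball])
    also have "\<dots> \<le> L * dist a b"
      using closest_point_lipschitz[OF convex_cball closed_cball ne] L by (intro mult_left_mono) auto
    finally show "dist (g a) (g b) \<le> L * dist a b" .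
  qed
  moreover have eq: "g y = f y" if "y \<in> ball z r" for y
    using that by (simp add: g_def closest_point_self)
  moreover have "D v \<le> c" if "y \<in> ball z r" "(g has_derivative D) (at y)" for y D
  proof -
    have "(f has_derivative D) (at y)"
      by (rule has_derivative_transform_within_open[OF that(2) open_ball that(1)]) (rule eq)
    then show ?thesis by (rule deriv[OF that(1)])
  qed
  ultimately have "g (x + T *\<^sub>R v) - g x \<le> c * T"
    using increment_le_if_derivatives_le_UNIV[OF _ open_ball T seg] by blast
  then show ?thesis using eq seg[of 0] seg[of T] T by simp
qed


section \<open>Comparison functions\<close>

lemma class_K_strict: "class_K \<gamma> \<Longrightarrow> 0 \<le> r \<Longrightarrow> r < s \<Longrightarrow> \<gamma> r < \<gamma> s"
  unfolding class_K_def by (auto elim!: strict_mono_onD)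

lemma class_K_mono: "class_K \<gamma> \<Longrightarrow> 0 \<le> r \<Longrightarrow> r \<le> s \<Longrightarrow> \<gamma> r \<le> \<gamma> s"
  using class_K_strict[of \<gamma> r s] by (cases "r = s") auto

lemma class_K_nonneg: "class_K \<gamma> \<Longrightarrow> 0 \<le> r \<Longrightarrow> 0 \<le> \<gamma> r"
  using class_K_mono[of \<gamma> 0 r] by (simp add: class_K_def)

lemma class_K_pos: "class_K \<gamma> \<Longrightarrow> 0 < r \<Longrightarrow> 0 < \<gamma> r"
  using class_K_strict[of \<gamma> 0 r] by (simp add: class_K_def)

lemma class_K_cont: "class_K \<gamma> \<Longrightarrow> continuous_on {0..} \<gamma>"
  by (simp add: class_K_def)

lemma class_Kinf_imp_K: "class_Kinf \<gamma> \<Longrightarrow> class_K \<gamma>"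
  by (simp add: class_Kinf_def)

lemma class_KinfI:
  assumes "class_K \<gamma>" "\<And>y. \<exists>x\<ge>0. y \<le> \<gamma> x"
  shows "class_Kinf \<gamma>"
  unfolding class_Kinf_def
proof
  show "\<not> bounded (\<gamma> ` {0..})"
  proof
    assume "bounded (\<gamma> ` {0..})"
    then obtain B where "\<And>x. 0 \<le> x \<Longrightarrow> \<bar>\<gamma> x\<bar> \<le> B" by (auto simp: bounded_iff)
    moreover obtain x where "0 \<le> x" "B + 1 \<le> \<gamma> x" using assms(2) by blast
    ultimately show False by fastforce
  qed
qed fact

lemma class_Kinf_unbounded:
  assumes "class_Kinf \<gamma>"
  shows "\<exists>x\<ge>0. y \<le> \<gamma> x"
proof (rule ccontr)
  assume "\<not> (\<exists>x\<ge>0. y \<le> \<gamma> x)"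
  then have "\<bar>\<gamma> x\<bar> \<le> y" if "0 \<le> x" for x
    using that class_K_nonneg[OF class_Kinf_imp_K[OF assms] that] by (metis abs_of_nonneg linear)
  then have "bounded (\<gamma> ` {0..})" by (auto simp: bounded_iff)
  then show False using assms by (simp add: class_Kinf_def)
qed

lemma class_Kinf_surj:
  assumes "class_Kinf \<gamma>" "0 \<le> y"
  shows "\<exists>x\<ge>0. \<gamma> x = y"
proof -
  obtain b where b: "0 \<le> b" "y \<le> \<gamma> b" using class_Kinf_unbounded[OF assms(1)] by blast
  have "\<exists>x\<ge>0. x \<le> b \<and> \<gamma> x = y"
    using assms b by (intro IVT' continuous_on_subset[OF class_K_cont[OF class_Kinf_imp_K]])
      (auto simp: class_Kinf_def class_K_def)
  then show ?thesis by blast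
qed

lemma Kinv_nonneg: "class_Kinf \<gamma> \<Longrightarrow> 0 \<le> y \<Longrightarrow> 0 \<le> Kinv \<gamma> y"
  and K_Kinv: "class_Kinf \<gamma> \<Longrightarrow> 0 \<le> y \<Longrightarrow> \<gamma> (Kinv \<gamma> y) = y"
proof -
  assume "class_Kinf \<gamma>" "0 \<le> y"
  then have y: "y \<in> \<gamma> ` {0..}" using class_Kinf_surj by fastforce
  show "0 \<le> Kinv \<gamma> y" using inv_into_into[OF y] by (simp add: Kinv_def)
  show "\<gamma> (Kinv \<gamma> y) = y" using f_inv_into_f[OF y] by (simp add: Kinv_def)
qed

lemma Kinv_K:
  assumes "class_Kinf \<gamma>" "0 \<le> x"
  shows "Kinv \<gamma> (\<gamma> x) = x"
proof -
  have "inj_on \<gamma> {0..}"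
    using assms(1) by (auto simp: class_Kinf_def class_K_def intro: strict_mono_on_imp_inj_on)
  then show ?thesis using assms(2) by (simp add: Kinv_def inv_into_f_f)
qed

lemma Kinv_le_iff:
  assumes "class_Kinf \<gamma>" "0 \<le> y" "0 \<le> r"
  shows "Kinv \<gamma> y \<le> r \<longleftrightarrow> y \<le> \<gamma> r"
  using class_K_mono[OF class_Kinf_imp_K[OF assms(1)], of "Kinv \<gamma> y" r]
    class_K_strict[OF class_Kinf_imp_K[OF assms(1)], of r "Kinv \<gamma> y"]
    Kinv_nonneg[OF assms(1,2)] K_Kinv[OF assms(1,2)] assms(3) by fastforce

lemma class_Kinf_Kinv:
  assumes K: "class_Kinf \<gamma>"
  shows "class_Kinf (Kinv \<gamma>)"
proof (rule class_KinfI)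
  note k = class_Kinf_imp_K[OF K]
  have strict: "Kinv \<gamma> r < Kinv \<gamma> s" if "0 \<le> r" "r < s" for r s
    using that Kinv_le_iff[OF K, of s "Kinv \<gamma> r"] K_Kinv[OF K, of r] Kinv_nonneg[OF K, of r]
    by fastforce
  have "continuous_on {0..} (Kinv \<gamma>)"
    unfolding continuous_on_eq_continuous_within
  proof
    fix y :: real assume y: "y \<in> {0..}"
    \<comment> \<open>Continuity of the inverse comes from compactness of \<open>{0..c}\<close>; the
      summand 1 puts y strictly below \<open>\<gamma> c\<close>, so that
      \<open>{0..\<gamma> c}\<close> is a neighbourhood of y in the half line.\<close>
    define c where "c = Kinv \<gamma> y + 1"
    have c: "0 \<le> c" using Kinv_nonneg[OF K, of y] y by (simp add: c_def)
    have yc: "y < \<gamma> c"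
      using class_K_strict[OF k, of "Kinv \<gamma> y" c] y Kinv_nonneg[OF K, of y] K_Kinv[OF K, of y]
      by (simp add: c_def)
    have "continuous_on (\<gamma> ` {0..c}) (Kinv \<gamma>)"
      by (rule continuous_on_inv[OF continuous_on_subset[OF class_K_cont[OF k]]])
        (auto simp: Kinv_K[OF K])
    moreover have "{0..\<gamma> c} \<subseteq> \<gamma> ` {0..c}"
    proof
      fix z assume z: "z \<in> {0..\<gamma> c}"
      then have "Kinv \<gamma> z \<in> {0..c}" using Kinv_le_iff[OF K _ c] Kinv_nonneg[OF K] by auto
      moreover have "z = \<gamma> (Kinv \<gamma> z)" using K_Kinv[OF K] z by auto
      ultimately show "z \<in> \<gamma> ` {0..c}" by blast
    qed
    ultimately have "continuous_on {0..\<gamma> c} (Kinv \<gamma>)" by (rule continuous_on_subset)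
    then have "continuous (at y within {0..\<gamma> c}) (Kinv \<gamma>)"
      using y yc by (simp add: continuous_on_eq_continuous_within)
    moreover have "at y within {0..\<gamma> c} = at y within {0..}"
      by (rule at_within_nhd[of _ "{..<\<gamma> c}"]) (use yc in auto)
    ultimately show "continuous (at y within {0..}) (Kinv \<gamma>)" by simp
  qed
  moreover have "Kinv \<gamma> 0 = 0" using Kinv_K[OF K, of 0] k by (simp add: class_K_def)
  ultimately show "class_K (Kinv \<gamma>)"
    using strict by (auto simp: class_K_def intro!: strict_mono_onI)
  show "\<exists>x\<ge>0. y \<le> Kinv \<gamma> x" for y
    using Kinv_K[OF K, of "\<bar>y\<bar>"] class_K_nonneg[OF k, of "\<bar>y\<bar>"]
    by (intro exI[of _ "\<gamma> \<bar>y\<bar>"]) auto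
qed

lemma class_Kinf_id: "class_Kinf (\<lambda>r. r)"
proof (rule class_KinfI)
  show "class_K (\<lambda>r. r)" by (auto simp: class_K_def intro!: strict_mono_onI)
  show "\<exists>x\<ge>0. y \<le> x" for y :: real by (intro exI[of _ "\<bar>y\<bar>"]) auto
qed

lemma class_Kinf_compose:
  assumes "class_Kinf a" "class_Kinf c"
  shows "class_Kinf (\<lambda>r. a (c r))"
proof (rule class_KinfI)
  note k = assms[THEN class_Kinf_imp_K]
  show "class_K (\<lambda>r. a (c r))"
    unfolding class_K_def
  proof (intro conjI strict_mono_onI)
    show "continuous_on {0..} (\<lambda>r. a (c r))"
      by (rule continuous_on_compose2[OF class_K_cont[OF k(1)] class_K_cont[OF k(2)]])
        (auto intro: class_K_nonneg[OF k(2)])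
    show "a (c r) < a (c s)" if "r \<in> {0..}" "r < s" for r s
      using that by (auto intro!: class_K_strict[OF k(1)] class_K_strict[OF k(2)] class_K_nonneg[OF k(2)])
    show "a (c 0) = 0" using k by (simp add: class_K_def)
  qed
  fix y
  obtain z where "0 \<le> z" "y \<le> a z" using class_Kinf_unbounded[OF assms(1)] by blast
  moreover obtain x where "0 \<le> x" "c x = z" using class_Kinf_surj[OF assms(2) \<open>0 \<le> z\<close>] by blast
  ultimately show "\<exists>x\<ge>0. y \<le> a (c x)" by blast
qed

lemma class_Kinf_scale: "0 < c \<Longrightarrow> class_Kinf (\<lambda>r. r * c)"
proof (rule class_KinfI)
  assume c: "0 < c"
  then show "class_K (\<lambda>r. r * c)"
    by (auto simp: class_K_def intro!: strict_mono_onI continuous_intros)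
  show "\<exists>x\<ge>0. y \<le> x * c" for y using c by (intro exI[of _ "\<bar>y\<bar> / c"]) auto
qed

lemma class_Kinf_min:
  assumes "class_Kinf a" "class_Kinf c"
  shows "class_Kinf (\<lambda>r. min (a r) (c r))"
proof (rule class_KinfI)
  note k = assms[THEN class_Kinf_imp_K]
  show "class_K (\<lambda>r. min (a r) (c r))"
    unfolding class_K_def
  proof (intro conjI strict_mono_onI)
    show "min (a r) (c r) < min (a s) (c s)" if "r \<in> {0..}" "r < s" for r s
      using class_K_strict[OF k(1), of r s] class_K_strict[OF k(2), of r s] that by auto
  qed (use k in \<open>auto simp: class_K_def intro!: continuous_intros\<close>)
  fix y
  obtain p q where "0 \<le> p" "y \<le> a p" "0 \<le> q" "y \<le> c q"
    using class_Kinf_unbounded[OF assms(1)] class_Kinf_unbounded[OF assms(2)] by metis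
  then show "\<exists>x\<ge>0. y \<le> min (a x) (c x)"
    using class_K_mono[OF k(1), of p "max p q"] class_K_mono[OF k(2), of q "max p q"]
    by (intro exI[of _ "max p q"]) auto
qed

lemma class_Kinf_max:
  assumes "class_Kinf a" "class_Kinf c"
  shows "class_Kinf (\<lambda>r. max (a r) (c r))"
proof (rule class_KinfI)
  note k = assms[THEN class_Kinf_imp_K]
  show "class_K (\<lambda>r. max (a r) (c r))"
    unfolding class_K_def
  proof (intro conjI strict_mono_onI)
    show "max (a r) (c r) < max (a s) (c s)" if "r \<in> {0..}" "r < s" for r s
      using class_K_strict[OF k(1), of r s] class_K_strict[OF k(2), of r s] that by auto
  qed (use k in \<open>auto simp: class_K_def intro!: continuous_intros\<close>)
  fix y
  obtain p where "0 \<le> p" "y \<le> a p" using class_Kinf_unbounded[OF assms(1)] by blast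
  then show "\<exists>x\<ge>0. y \<le> max (a x) (c x)" by (intro exI[of _ p]) auto
qed

lemma class_Kinf_finite_bounds:
  assumes "finite I" "\<And>i. i \<in> I \<Longrightarrow> class_Kinf (g i)"
  shows "\<exists>l u. class_Kinf l \<and> class_Kinf u \<and> (\<forall>i\<in>I. \<forall>r. l r \<le> g i r \<and> g i r \<le> u r)"
  using assms
proof induction
  case empty
  show ?case using class_Kinf_id by blast
next
  case (insert i I)
  then obtain l u where "class_Kinf l" "class_Kinf u" "\<And>i r. i \<in> I \<Longrightarrow> l r \<le> g i r \<and> g i r \<le> u r"
    by (metis insertI2)
  with insert.prems show ?case
    by (intro exI[of _ "\<lambda>r. min (g i r) (l r)"] exI[of _ "\<lambda>r. max (g i r) (u r)"])
      (auto intro: class_Kinf_min class_Kinf_max min.coboundedI2 max.coboundedI2)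
qed

text \<open>The minorant is an infimal convolution with the distance, hence 1-Lipschitz.\<close>

lemma pos_def_minorant:
  fixes P :: "real \<Rightarrow> real \<Rightarrow> bool"
  assumes "\<And>a c. 0 < a \<Longrightarrow> a \<le> c \<Longrightarrow> \<exists>m>0. \<forall>t\<in>{a..c}. \<forall>y. P t y \<longrightarrow> m \<le> y"
  shows "\<exists>\<alpha>. pos_def_fun \<alpha> \<and> (\<forall>t>0. \<forall>y. P t y \<longrightarrow> \<alpha> t \<le> y)"
proof -
  \<comment> \<open>The point (0, 0) keeps the infimum over a nonempty set and forces
    \<open>\<alpha> 0 = 0\<close>.\<close>
  define S where "S = insert (0, 0) {(t, y). 0 < t \<and> P t y}"
  define \<alpha> where "\<alpha> s = (INF p\<in>S. snd p + \<bar>s - fst p\<bar>)" for s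
  have nn: "0 \<le> snd p" if "p \<in> S" for p
    using that assms[of "fst p" "fst p"] by (force simp: S_def)
  have ne: "S \<noteq> {}" by (simp add: S_def)
  have bb: "bdd_below ((\<lambda>p. snd p + \<bar>s - fst p\<bar>) ` S)" for s
    using nn by (auto intro!: bdd_belowI[of _ 0] add_nonneg_nonneg)
  have le: "\<alpha> s \<le> snd p + \<bar>s - fst p\<bar>" if "p \<in> S" for p s
    unfolding \<alpha>_def using bb that by (rule cINF_lower)
  have lip: "\<alpha> s \<le> \<alpha> t + \<bar>s - t\<bar>" for s t
  proof -
    have "\<alpha> s - \<bar>s - t\<bar> \<le> \<alpha> t"
      unfolding \<alpha>_def[of t] using le by (intro cINF_greatest ne) (smt (verit))
    then show ?thesis by simp
  qed
  have "1-lipschitz_on {0..} \<alpha>"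
  proof (rule lipschitz_onI)
    show "dist (\<alpha> s) (\<alpha> t) \<le> 1 * dist s t" for s t
      using lip[of s t] lip[of t s] by (auto simp: dist_real_def abs_le_iff abs_minus_commute)
  qed simp
  then have "continuous_on {0..} \<alpha>" by (rule lipschitz_on_continuous_on)
  moreover have nonneg: "0 \<le> \<alpha> s" for s
    unfolding \<alpha>_def using nn by (intro cINF_greatest ne add_nonneg_nonneg) auto
  moreover have "\<alpha> 0 = 0" using nonneg[of 0] le[of "(0, 0)" 0] by (simp add: S_def)
  moreover have "0 < \<alpha> s" if s: "0 < s" for s
  proof -
    obtain m where m: "m > 0" "\<And>t y. t \<in> {s / 2 .. 2 * s} \<Longrightarrow> P t y \<Longrightarrow> m \<le> y"
      using assms[of "s / 2" "2 * s"] s by auto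
    \<comment> \<open>Pairs with first entry in the window contribute at least \<open>m\<close>; all
      others are at distance at least \<open>s / 2\<close> from s.\<close>
    have "min m (s / 2) \<le> snd p + \<bar>s - fst p\<bar>" if p: "p \<in> S" for p
    proof (cases "fst p \<in> {s / 2 .. 2 * s}")
      case True
      then have "P (fst p) (snd p)" using p s by (auto simp: S_def)
      then show ?thesis using m(2)[OF True] by (simp add: min.coboundedI1 add_increasing2)
    next
      case False
      then have "s / 2 \<le> \<bar>s - fst p\<bar>" using s by (auto simp: not_le abs_if)
      then show ?thesis using nn[OF p] by (simp add: min.coboundedI2)
    qed
    then have "min m (s / 2) \<le> \<alpha> s" unfolding \<alpha>_def by (intro cINF_greatest ne)
    then show ?thesis using m(1) s by auto
  qed
  ultimately have "pos_def_fun \<alpha>"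
    by (auto simp: pos_def_fun_def) (metis less_eq_real_def less_irrefl)
  moreover have "\<alpha> t \<le> y" if "t > 0" "P t y" for t y
    using le[of "(t, y)" t] that by (simp add: S_def)
  ultimately show ?thesis by blast
qed

text \<open>Axiom (M2) compares only vectors that differ strictly in every entry. Raising all
  entries of \<open>t\<close> by 1 / (n + 1) and passing to the limit gives weak
  monotonicity.\<close>

lemma MAF_mono:
  fixes \<mu> :: "real ^ 'm::finite \<Rightarrow> real"
  assumes "MAF \<mu>" "s \<in> orthant" "t \<in> orthant" "\<And>k. s $ k \<le> t $ k"
  shows "\<mu> s \<le> \<mu> t"
proof -
  define T where "T n = t + (\<chi> k. 1 / real (Suc n))" for n
  have T: "T n \<in> orthant" for n using assms(3) by (auto simp: T_def orthant_def)
  have "T \<longlonglongrightarrow> t + (\<chi> k. 0)"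
    unfolding T_def[abs_def]
    by (intro tendsto_add tendsto_const tendsto_vec_lambda LIMSEQ_Suc[OF lim_1_over_n])
  moreover have "(\<chi> k. 0) = (0 :: real ^ 'm)" by (simp add: vec_eq_iff)
  ultimately have lim: "T \<longlonglongrightarrow> t" by simp
  have "continuous_on orthant \<mu>" using assms(1) by (simp add: MAF_def)
  from continuous_on_tendsto_compose[OF this lim assms(3)] T
  have "(\<lambda>n. \<mu> (T n)) \<longlonglongrightarrow> \<mu> t" by simp
  moreover have "\<mu> s \<le> \<mu> (T n)" for n
  proof -
    have "vless s (T n)" using add_le_less_mono[OF assms(4), of 0 "1 / real (Suc n)"] by (simp add: vless_def T_def)
    then show ?thesis using assms(1,2) T by (auto simp: MAF_def intro: less_imp_le)
  qed
  ultimately show ?thesis by (intro LIMSEQ_le_const) auto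
qed

section \<open>Decomposition of the state into blocks\<close>

lemma part_in_block [simp]: "part b i x \<in> block b i"
  by (simp add: part_def block_def)

lemma part_block: "x \<in> block b i \<Longrightarrow> part b i x = x"
  by (auto simp: part_def block_def vec_eq_iff)

lemma part_part [simp]: "part b i (part b i x) = part b i x"
  by (rule part_block) simp

lemma bounded_linear_part: "bounded_linear (part b i)"
  unfolding linear_conv_bounded_linear[symmetric]
  by (rule linearI) (auto simp: part_def vec_eq_iff)


lemma part_add: "part b i (x + y) = part b i x + part b i y"
  and part_diff: "part b i (x - y) = part b i x - part b i y"
  and part_scaleR: "part b i (c *\<^sub>R x) = c *\<^sub>R part b i x"
  by (auto simp: part_def vec_eq_iff)

lemma norm_part_le: "norm (part b i x) \<le> norm x"
  by (rule norm_le_componentwise_cart) (auto simp: part_def)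

lemma sum_part:
  fixes b :: "'k::finite \<Rightarrow> 'n::finite"
  shows "(\<Sum>i\<in>UNIV. part b i x) = x"
  by (simp add: vec_eq_iff part_def sum.delta)

text \<open>The norm of x is at most the sum of the norms of its parts, so not all of them can lie
  below the average.\<close>

lemma norm_le_part:
  fixes b :: "'k::finite \<Rightarrow> 'n::finite"
  shows "\<exists>i. norm x / CARD('n) \<le> norm (part b i x)"
proof (rule ccontr)
  assume "\<not> ?thesis"
  then have "(\<Sum>i\<in>UNIV. norm (part b i x)) < (\<Sum>i\<in>(UNIV :: 'n set). norm x / CARD('n))"
    by (intro sum_strict_mono) (auto simp: not_le)
  also have "\<dots> = norm x" by simp
  finally show False using norm_sum[of "\<lambda>i. part b i x" UNIV] by (simp add: sum_part)
qed


section \<open>The interconnected system\<close>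

lemma continuous_on_MAX:
  fixes g :: "'i \<Rightarrow> 'a::topological_space \<Rightarrow> real"
  assumes "finite I" "I \<noteq> {}" "\<And>i. i \<in> I \<Longrightarrow> continuous_on S (g i)"
  shows "continuous_on S (\<lambda>x. MAX i\<in>I. g i x)"
  using assms
proof (induction rule: finite_ne_induct)
  case (insert i I)
  then have "(\<lambda>x. MAX i\<in>insert i I. g i x) = (\<lambda>x. max (g i x) (MAX i\<in>I. g i x))"
    by (auto simp: image_insert)
  then show ?case using insert by (auto intro!: continuous_on_max)
qed simp

lemma ex_uniform_lower_bound:
  fixes P :: "'i::finite \<Rightarrow> real \<Rightarrow> bool"
  assumes "\<And>i. \<exists>m>0. P i m" "\<And>i m m'. P i m \<Longrightarrow> 0 < m' \<Longrightarrow> m' \<le> m \<Longrightarrow> P i m'"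
  shows "\<exists>m>0. \<forall>i. P i m"
proof -
  obtain m where m: "\<And>i. 0 < m i" "\<And>i. P i (m i)" using assms(1) by metis
  have "0 < (MIN i. m i)" using m(1) by simp
  moreover have "P i (MIN i. m i)" for i
    by (rule assms(2)[OF m(2)]) (use m(1) in auto)
  ultimately show ?thesis by blast
qed

locale interconnection =
  fixes b :: "'k::finite \<Rightarrow> 'n::finite"
    and f :: "real ^ 'k \<Rightarrow> real ^ 'm::finite \<Rightarrow> real ^ 'k"
    and V :: "'n \<Rightarrow> real ^ 'k \<Rightarrow> real"
    and \<mu> :: "'n \<Rightarrow> real ^ 'n option \<Rightarrow> real"
    and \<gamma> :: "'n \<Rightarrow> 'n \<Rightarrow> real \<Rightarrow> real"
    and \<gamma>u :: "'n \<Rightarrow> real \<Rightarrow> real"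
    and \<sigma> :: "'n \<Rightarrow> real \<Rightarrow> real"
  assumes continuous: "\<forall>u. continuous_on UNIV (\<lambda>x. f x u)"
    and candidates: "\<forall>i. lyapunov_candidate_on (block b i) (V i)"
    and maf: "\<forall>i. MAF (\<mu> i)"
    and gains: "\<forall>i j. class_Kinf (\<gamma> i j) \<or> zero_gain (\<gamma> i j)"
    and gains_input: "\<forall>i. class_K (\<gamma>u i) \<or> zero_gain (\<gamma>u i)"
    and lyapunov: "\<forall>i. subsystem_iss_lyapunov b f V \<mu> \<gamma> \<gamma>u i"
    and path: "Omega_path (gain_op \<mu> \<gamma> \<gamma>u) \<sigma>"
begin

abbreviation "Vp i x \<equiv> V i (part b i x)"
abbreviation "W i x \<equiv> Kinv (\<sigma> i) (Vp i x)"
abbreviation "Vmax \<equiv> overall_V b \<sigma> V"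

text \<open>This is the common consequence of the two premises on \<open>\<phi>\<close>: the input
  is so small relative to the level r that the gain inequality on the path remains strict.\<close>

definition dominated :: "real \<Rightarrow> real ^ 'm \<Rightarrow> bool" where
  "dominated r u \<longleftrightarrow> (\<forall>i. \<mu> i (vjoin (\<chi> j. \<gamma> i j (\<sigma> j r)) (\<gamma>u i (norm u))) < \<sigma> i r)"

definition decay_rate :: "'n \<Rightarrow> (real \<Rightarrow> real) \<Rightarrow> bool" where
  "decay_rate i \<alpha> \<longleftrightarrow> pos_def_fun \<alpha> \<and>
     (\<forall>x u D. (V i has_derivative D) (at (part b i x) within block b i) \<longrightarrow>
        \<mu> i (vjoin (\<chi> j. \<gamma> i j (Vp j x)) (\<gamma>u i (norm u))) \<le> Vp i x \<longrightarrow>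
        D (part b i (f x u)) \<le> - \<alpha> (norm (part b i x)))"

lemma ex_decay_rate: "\<exists>\<alpha>. decay_rate i \<alpha>"
  using lyapunov by (auto simp: subsystem_iss_lyapunov_def decay_rate_def)

lemma Kinf_\<sigma>: "class_Kinf (\<sigma> i)"
  using path by (simp add: Omega_path_def)

lemmas K_\<sigma> = class_Kinf_imp_K[OF Kinf_\<sigma>]

lemma gain_facts:
  shows gain_cont: "continuous_on {0..} (\<gamma> i j)"
    and gain_nonneg: "0 \<le> r \<Longrightarrow> 0 \<le> \<gamma> i j r"
    and gain_mono: "0 \<le> r \<Longrightarrow> r \<le> s \<Longrightarrow> \<gamma> i j r \<le> \<gamma> i j s"
proof -
  show "continuous_on {0..} (\<gamma> i j)"
  proof (cases "zero_gain (\<gamma> i j)")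
    case True
    then show ?thesis
      by (intro continuous_on_eq[OF continuous_on_const[of _ 0]]) (auto simp: zero_gain_def)
  qed (use gains class_K_cont class_Kinf_imp_K in blast)
  show "0 \<le> r \<Longrightarrow> 0 \<le> \<gamma> i j r"
    using gains class_K_nonneg class_Kinf_imp_K unfolding zero_gain_def by (metis order_refl)
  show "0 \<le> r \<Longrightarrow> r \<le> s \<Longrightarrow> \<gamma> i j r \<le> \<gamma> i j s"
    using gains class_K_mono class_Kinf_imp_K unfolding zero_gain_def by (metis order_refl order_trans)
qed

lemma input_gain_nonneg: "0 \<le> r \<Longrightarrow> 0 \<le> \<gamma>u i r"
  using gains_input class_K_nonneg unfolding zero_gain_def by (metis order_refl)

lemma input_gain_mono: "0 \<le> r \<Longrightarrow> r \<le> s \<Longrightarrow> \<gamma>u i r \<le> \<gamma>u i s"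
  using gains_input class_K_mono unfolding zero_gain_def by (metis order_refl order_trans)

section \<open>Continuity, positivity and bounds of the candidate function\<close>

lemma Vp_bounds:
  obtains \<psi>1 \<psi>2 where "class_Kinf \<psi>1" "class_Kinf \<psi>2"
    "\<And>x. \<psi>1 (norm (part b i x)) \<le> Vp i x" "\<And>x. Vp i x \<le> \<psi>2 (norm (part b i x))"
  using candidates unfolding lyapunov_candidate_on_def by (metis part_in_block)

lemma Vp_nonneg: "0 \<le> Vp i x"
  by (rule Vp_bounds[of i]) (meson class_K_nonneg class_Kinf_imp_K norm_ge_zero order_trans)

lemma Vp_pos_iff: "0 < Vp i x \<longleftrightarrow> part b i x \<noteq> 0"
proof (rule Vp_bounds[of i])
  fix \<psi>1 \<psi>2 assume *: "class_Kinf \<psi>1" "class_Kinf \<psi>2"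
    "\<And>x. \<psi>1 (norm (part b i x)) \<le> Vp i x" "\<And>x. Vp i x \<le> \<psi>2 (norm (part b i x))"
  have "\<psi>2 0 = 0" using *(2) by (simp add: class_Kinf_def class_K_def)
  then show ?thesis
    using *(3,4)[of x] class_K_pos[OF class_Kinf_imp_K[OF *(1)], of "norm (part b i x)"]
    by (cases "part b i x = 0") auto
qed

lemma cont_Vp: "continuous_on UNIV (Vp i)"
proof (rule continuous_on_compose2[of "block b i" "V i" UNIV "part b i"])
  show "continuous_on (block b i) (V i)" using candidates by (simp add: lyapunov_candidate_on_def)
  show "continuous_on UNIV (part b i)" using bounded_linear_part by (rule linear_continuous_on)
qed auto

lemma cont_W: "continuous_on UNIV (W i)"
  by (rule continuous_on_compose2[OF class_K_cont[OF class_Kinf_imp_K[OF class_Kinf_Kinv[OF Kinf_\<sigma>]]] cont_Vp])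
    (auto simp: Vp_nonneg)

lemma W_nonneg: "0 \<le> W i x"
  using Kinv_nonneg[OF Kinf_\<sigma> Vp_nonneg] .

lemma \<sigma>_W: "\<sigma> i (W i x) = Vp i x"
  by (rule K_Kinv[OF Kinf_\<sigma> Vp_nonneg])

lemma W_le_Vmax: "W i x \<le> Vmax x"
  unfolding overall_V_def by (rule Max_ge) auto

lemma Vmax_attained: "\<exists>i. W i x = Vmax x"
proof -
  have "Vmax x \<in> range (\<lambda>i. W i x)" unfolding overall_V_def by (rule Max_in) auto
  then show ?thesis by force
qed

lemma Vmax_le_iff: "Vmax x \<le> r \<longleftrightarrow> (\<forall>i. W i x \<le> r)"
  unfolding overall_V_def by (subst Max_le_iff) auto

lemma cont_Vmax: "continuous_on UNIV Vmax"
  unfolding overall_V_def[abs_def] by (rule continuous_on_MAX) (auto intro: cont_W)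

lemma Vp_le_\<sigma>_Vmax: "Vp i x \<le> \<sigma> i (Vmax x)"
  using class_K_mono[OF K_\<sigma>[of i] W_nonneg[of i x] W_le_Vmax[of i x]] by (simp add: \<sigma>_W)

lemma Vmax_bounds:
  obtains \<psi>1 \<psi>2 where "class_Kinf \<psi>1" "class_Kinf \<psi>2"
    "\<And>x. \<psi>1 (norm x) \<le> Vmax x" "\<And>x. Vmax x \<le> \<psi>2 (norm x)"
proof -
  have "\<forall>i. \<exists>p1 p2. class_Kinf p1 \<and> class_Kinf p2 \<and>
     (\<forall>x. p1 (norm (part b i x)) \<le> Vp i x \<and> Vp i x \<le> p2 (norm (part b i x)))"
    by (metis Vp_bounds)
  then obtain p1 p2 where p: "\<And>i. class_Kinf (p1 i)" "\<And>i. class_Kinf (p2 i)"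
    "\<And>i x. p1 i (norm (part b i x)) \<le> Vp i x" "\<And>i x. Vp i x \<le> p2 i (norm (part b i x))"
    by metis
  note Kinf_Kinv = class_Kinf_Kinv[OF Kinf_\<sigma>]
  \<comment> \<open>Some part of x has norm at least \<open>norm x * c\<close>; this produces the
    lower bound.\<close>
  define c where "c = 1 / real CARD('n)"
  have c: "0 < c" by (simp add: c_def)
  obtain l where l: "class_Kinf l" "\<And>i r. l r \<le> Kinv (\<sigma> i) (p1 i (r * c))"
    using class_Kinf_finite_bounds[of UNIV "\<lambda>i r. Kinv (\<sigma> i) (p1 i (r * c))"]
      class_Kinf_compose[OF Kinf_Kinv class_Kinf_compose[OF p(1) class_Kinf_scale[OF c]]] by auto
  obtain u where u: "class_Kinf u" "\<And>i r. Kinv (\<sigma> i) (p2 i r) \<le> u r"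
    using class_Kinf_finite_bounds[of UNIV "\<lambda>i r. Kinv (\<sigma> i) (p2 i r)"]
      class_Kinf_compose[OF Kinf_Kinv p(2)] by auto
  note mono = class_K_mono[OF class_Kinf_imp_K[OF Kinf_Kinv]]
  have "l (norm x) \<le> Vmax x" for x
  proof -
    obtain i where i: "norm x * c \<le> norm (part b i x)" using norm_le_part[of x b] by (auto simp: c_def)
    have "l (norm x) \<le> Kinv (\<sigma> i) (p1 i (norm x * c))" by (rule l(2))
    also have "\<dots> \<le> W i x"
      using c i by (intro mono order_trans[OF class_K_mono[OF class_Kinf_imp_K[OF p(1)]] p(3)]
          class_K_nonneg[OF class_Kinf_imp_K[OF p(1)]]) auto
    also have "\<dots> \<le> Vmax x" by (rule W_le_Vmax)
    finally show ?thesis .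
  qed
  moreover have "Vmax x \<le> u (norm x)" for x
    unfolding Vmax_le_iff
  proof
    fix i
    have "W i x \<le> Kinv (\<sigma> i) (p2 i (norm x))"
      by (intro mono Vp_nonneg order_trans[OF p(4)] class_K_mono[OF class_Kinf_imp_K[OF p(2)]] norm_part_le) auto
    then show "W i x \<le> u (norm x)" using u(2)[of i "norm x"] by linarith
  qed
  ultimately show ?thesis using that l(1) u(1) by blast
qed

lemma Vmax_nonneg: "0 \<le> Vmax x"
  using W_nonneg W_le_Vmax order_trans by blast

lemma Vmax_pos: "x \<noteq> 0 \<Longrightarrow> 0 < Vmax x"
  by (rule Vmax_bounds) (metis class_K_pos class_Kinf_imp_K less_le_trans zero_less_norm_iff)

lemma Vp_local_lipschitz:
  assumes "part b i x \<noteq> 0"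
  obtains d L where "0 < d" "L-lipschitz_on (cball x d) (Vp i)" "\<And>y. y \<in> cball x d \<Longrightarrow> part b i y \<noteq> 0"
proof -
  have dist_part: "dist (part b i y) (part b i z) \<le> dist y z" for y z
    using norm_part_le[of b i "y - z"] by (simp add: dist_norm part_diff)
  have "local_lipschitz {0::real} (block b i - {0}) (\<lambda>_. V i)"
    using candidates by (simp add: lyapunov_candidate_on_def locally_lipschitz_on_def)
  then obtain u L where u: "0 < u" "L-lipschitz_on (cball (part b i x) u \<inter> (block b i - {0})) (V i)"
    by (rule local_lipschitzE[of _ _ _ 0 "part b i x"]) (use assms in \<open>auto dest: spec[of _ 0]\<close>)
  \<comment> \<open>Half of the norm of the part keeps it away from 0 on the ball, where alone
    \<open>V i\<close> is known to be Lipschitz.\<close>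
  define d where "d = min u (norm (part b i x) / 2)"
  have d: "0 < d" using u(1) assms by (simp add: d_def)
  have ne: "part b i y \<noteq> 0" if "y \<in> cball x d" for y
  proof
    assume "part b i y = 0"
    then have "norm (part b i x) \<le> d" using dist_part[of x y] that by simp
    then show False using assms by (simp add: d_def)
  qed
  have "L-lipschitz_on (cball x d) (Vp i)"
  proof (rule lipschitz_onI)
    show "0 \<le> L" using u(2) by (rule lipschitz_on_nonneg)
    fix y z assume yz: "y \<in> cball x d" "z \<in> cball x d"
    then have "part b i w \<in> cball (part b i x) u \<inter> (block b i - {0})" if "w \<in> {y, z}" for w
      using that ne dist_part[of x w] by (auto simp: d_def)
    then have "dist (Vp i y) (Vp i z) \<le> L * dist (part b i y) (part b i z)"
      by (intro lipschitz_onD[OF u(2)]) auto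
    also have "\<dots> \<le> L * dist y z" using \<open>0 \<le> L\<close> dist_part by (rule mult_left_mono[rotated])
    finally show "dist (Vp i y) (Vp i z) \<le> L * dist y z" .
  qed
  then show ?thesis using that d ne by blast
qed

section \<open>Lipschitz and slope bounds for the inverse path\<close>

lemma local_lipschitz_Kinv: "local_lipschitz {0::real} {0<..} (\<lambda>_. Kinv (\<sigma> i))"
  using path by (simp add: Omega_path_def locally_lipschitz_on_def)

lemma Kinv_lipschitz_compact:
  assumes "compact K" "K \<subseteq> {0<..}"
  obtains L where "L-lipschitz_on K (Kinv (\<sigma> i))"
proof -
  have "local_lipschitz {0::real} K (\<lambda>_. Kinv (\<sigma> i))"
    using local_lipschitz_subset[OF local_lipschitz_Kinv order_refl assms(2)] .
  then show ?thesis
    using local_lipschitz_compact_implies_lipschitz[of "{0::real}" K "\<lambda>_. Kinv (\<sigma> i)"] assms(1) that by auto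
qed

lemma W_local_lipschitz:
  assumes "part b i x \<noteq> 0"
  obtains d L where "0 < d" "L-lipschitz_on (cball x d) (W i)"
proof -
  obtain d L where d: "0 < d" "L-lipschitz_on (cball x d) (Vp i)" "\<And>y. y \<in> cball x d \<Longrightarrow> part b i y \<noteq> 0"
    using Vp_local_lipschitz[OF assms] by metis
  have "compact (Vp i ` cball x d)"
    by (intro compact_continuous_image continuous_on_subset[OF cont_Vp]) auto
  moreover have "Vp i ` cball x d \<subseteq> {0<..}" using d(3) Vp_pos_iff by auto
  ultimately obtain M where "M-lipschitz_on (Vp i ` cball x d) (Kinv (\<sigma> i))"
    using Kinv_lipschitz_compact[where i = i] by blast
  from lipschitz_on_compose2[OF d(2) this] show ?thesis using that d(1) by blast
qed

text \<open>The path condition bounds derivatives only where they exist. The increment lemma,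
  applied to the negative of \<open>Kinv (\<sigma> i)\<close>, turns this into a bound on
  differences.\<close>

lemma Kinv_slope:
  assumes a: "0 < a" "a < B"
  shows "\<exists>c>0. \<forall>i. \<forall>p\<in>{a..B}. \<forall>q\<in>{p..B}. c * (q - p) \<le> Kinv (\<sigma> i) q - Kinv (\<sigma> i) p"
proof -
  \<comment> \<open>The open ball runs from \<open>a / 2\<close> to \<open>B + a / 2\<close>: it
    contains \<open>{a..B}\<close>, and its closure remains in the positive half line.\<close>
  define z r where "z = (a + B) / 2" and "r = B / 2"
  have cb: "cball z r = {a / 2..B + a / 2}" and bl: "ball z r = {a / 2<..<B + a / 2}"
    unfolding cball_eq_atLeastAtMost ball_eq_greaterThanLessThan by (simp_all add: z_def r_def field_simps)
  have K: "compact (cball z r)" "cball z r \<subseteq> {0<..}" using a by (auto simp: cb)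
  then obtain c where c: "0 < c"
      "\<And>i s d. s \<in> cball z r \<Longrightarrow> (Kinv (\<sigma> i) has_real_derivative d) (at s) \<Longrightarrow> c \<le> d"
    using path unfolding Omega_path_def by meson
  have "c * (q - p) \<le> Kinv (\<sigma> i) q - Kinv (\<sigma> i) p" if pq: "p \<in> {a..B}" "q \<in> {p..B}" for i p q
  proof -
    obtain L where L: "L-lipschitz_on (cball z r) (Kinv (\<sigma> i))" using Kinv_lipschitz_compact[OF K] by metis
    have "- Kinv (\<sigma> i) (p + (q - p) *\<^sub>R 1) - - Kinv (\<sigma> i) p \<le> - c * (q - p)"
    proof (rule increment_le_if_derivatives_le)
      show "L-lipschitz_on (cball z r) (\<lambda>s. - Kinv (\<sigma> i) s)" using L by (rule lipschitz_on_minus)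
      show "D 1 \<le> - c" if "y \<in> ball z r" "((\<lambda>s. - Kinv (\<sigma> i) s) has_derivative D) (at y)" for y D
      proof -
        have "((\<lambda>s. - Kinv (\<sigma> i) s) has_real_derivative D 1) (at y)"
          using has_real_derivative_line[of _ D 0 y 1] that(2) by simp
        from DERIV_minus[OF this] have "(Kinv (\<sigma> i) has_real_derivative - D 1) (at y)" by simp
        then show ?thesis using c(2)[of y i "- D 1"] that(1) by simp
      qed
    qed (use pq a bl in auto)
    then show ?thesis by (simp add: algebra_simps)
  qed
  with c(1) show ?thesis by blast
qed

lemma cont_gain: "continuous_on UNIV (\<lambda>y. \<mu> i (vjoin (\<chi> j. \<gamma> i j (Vp j y)) (\<gamma>u i (norm u))))"
proof (rule continuous_on_compose2[of orthant "\<mu> i"])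
  show "continuous_on orthant (\<mu> i)" using maf by (simp add: MAF_def)
  have "continuous_on UNIV (\<lambda>y. \<gamma> i j (Vp j y))" for j
    by (rule continuous_on_compose2[OF gain_cont cont_Vp]) (auto simp: Vp_nonneg)
  then have "continuous_on UNIV (\<lambda>y. case k of None \<Rightarrow> \<gamma>u i (norm u) | Some j \<Rightarrow> \<gamma> i j (Vp j y))" for k
    by (cases k) auto
  then show "continuous_on UNIV (\<lambda>y. vjoin (\<chi> j. \<gamma> i j (Vp j y)) (\<gamma>u i (norm u)))"
    unfolding vjoin_def by (simp add: continuous_on_vec_lambda cong: option.case_cong)
qed (auto simp: vjoin_def orthant_def gain_nonneg Vp_nonneg input_gain_nonneg split: option.split)

text \<open>All \<open>Vp j x\<close> lie below the path at level \<open>Vmax x\<close>, and for the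
  active index \<open>Vp i x\<close> lies on it. Monotonicity replaces the state by the path point,
  where \<open>dominated\<close> applies.\<close>

lemma gain_condition:
  assumes dom: "dominated (Vmax x) u" and active: "W i x = Vmax x"
  shows "\<mu> i (vjoin (\<chi> j. \<gamma> i j (Vp j x)) (\<gamma>u i (norm u))) < Vp i x"
proof -
  have "\<mu> i (vjoin (\<chi> j. \<gamma> i j (Vp j x)) (\<gamma>u i (norm u)))
      \<le> \<mu> i (vjoin (\<chi> j. \<gamma> i j (\<sigma> j (Vmax x))) (\<gamma>u i (norm u)))"
    by (rule MAF_mono[OF maf[rule_format]])
      (auto simp: vjoin_def orthant_def gain_nonneg Vp_nonneg input_gain_nonneg class_K_nonneg[OF K_\<sigma>]
        Vmax_nonneg intro!: gain_mono Vp_le_\<sigma>_Vmax split: option.split)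
  also have "\<dots> < \<sigma> i (Vmax x)" using dom by (simp add: dominated_def)
  also have "\<dots> = Vp i x" using \<sigma>_W[of i x] active by simp
  finally show ?thesis .
qed

text \<open>On the block, \<open>V i\<close> is \<open>Vp i\<close> restricted to the affine
  subspace through y parallel to the block. This connects derivatives on the full space, supplied by
  Rademacher's theorem, with the derivatives in the subsystem hypothesis.\<close>

lemma has_derivative_block:
  assumes "(Vp i has_derivative D) (at y)"
  shows "(V i has_derivative D) (at (part b i y) within block b i)"
proof (rule has_derivative_transform)
  have "((\<lambda>z. z + (y - part b i y)) has_derivative (\<lambda>h. h)) (at (part b i y) within block b i)"
    by (auto intro!: derivative_eq_intros)
  from has_derivative_compose[OF this, of "Vp i" D] assms
  show "((\<lambda>z. Vp i (z + (y - part b i y))) has_derivative D) (at (part b i y) within block b i)"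
    by simp
  show "V i z = Vp i (z + (y - part b i y))" if "z \<in> block b i" for z
    using that by (simp add: part_block part_add part_diff)
qed simp

text \<open>\<open>Vp i\<close> is constant along directions whose part in block i vanishes.\<close>

lemma derivative_part:
  assumes D: "(Vp i has_derivative D) (at y)"
  shows "D (part b i w) = D w"
proof -
  interpret D: bounded_linear D using D by (rule has_derivative_bounded_linear)
  let ?w = "w - part b i w"
  have "((\<lambda>t. Vp i (y + t *\<^sub>R ?w)) has_real_derivative D ?w) (at 0)"
    using has_real_derivative_line[of "Vp i" D y 0 ?w] D by simp
  moreover have "Vp i (y + t *\<^sub>R ?w) = Vp i y" for t
    by (simp add: part_add part_diff
        part_scaleR)
  ultimately have "((\<lambda>t. Vp i y) has_real_derivative D ?w) (at 0)" by simp
  then have "D ?w = 0" using DERIV_unique DERIV_const by blast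
  then show ?thesis by (simp add: D.diff)
qed

lemma Vp_decay:
  assumes \<alpha>: "decay_rate i \<alpha>" and dom: "dominated (Vmax x) u"
    and active: "W i x = Vmax x" and x: "part b i x \<noteq> 0" and \<kappa>: "\<kappa> < \<alpha> (norm (part b i x))"
  shows "\<exists>\<delta>>0. \<forall>t\<in>{0..\<delta>}. Vp i (x + t *\<^sub>R f x u) - Vp i x \<le> - \<kappa> * t"
proof -
  define v where "v = f x u"
  define \<kappa>' where "\<kappa>' = (\<kappa> + \<alpha> (norm (part b i x))) / 2"
  have \<kappa>': "\<kappa> < \<kappa>'" "\<kappa>' < \<alpha> (norm (part b i x))" using \<kappa> by (simp_all add: \<kappa>'_def)
  obtain d L where d: "0 < d" "L-lipschitz_on (cball x d) (Vp i)"
    using Vp_local_lipschitz[OF x] by metis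
  let ?G = "\<lambda>y. \<mu> i (vjoin (\<chi> j. \<gamma> i j (Vp j y)) (\<gamma>u i (norm u)))"
  have ev1: "\<forall>\<^sub>F y in nhds x. ?G y < Vp i y"
    using gain_condition[OF dom active] open_Collect_less[OF cont_gain cont_Vp, of i u i]
    by (auto simp: eventually_nhds)
  have "continuous_on UNIV (\<lambda>y. \<alpha> (norm (part b i y)))"
  proof (rule continuous_on_compose2[of "{0..}" \<alpha>])
    show "continuous_on {0..} \<alpha>" using \<alpha> by (simp add: decay_rate_def pos_def_fun_def)
    show "continuous_on UNIV (\<lambda>y. norm (part b i y))"
      by (intro continuous_on_norm linear_continuous_on bounded_linear_part)
  qed auto
  from open_Collect_less[OF continuous_on_const this, of \<kappa>']
  have ev2: "\<forall>\<^sub>F y in nhds x. \<kappa>' < \<alpha> (norm (part b i y))"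
    using \<kappa>'(2) by (auto simp: eventually_nhds)
  have "continuous_on UNIV (\<lambda>y. L * norm (v - f y u))"
    using continuous by (intro continuous_intros) auto
  note op = open_Collect_less[OF this continuous_on_const, of "\<kappa>' - \<kappa>"]
  have ev3: "\<forall>\<^sub>F y in nhds x. L * norm (v - f y u) < \<kappa>' - \<kappa>"
    using eventually_nhds_in_open[OF op, of x] \<kappa>'(1) by (simp add: v_def)
  obtain e where e: "0 < e" "\<And>y. dist y x < e \<Longrightarrow> ?G y < Vp i y \<and> \<kappa>' < \<alpha> (norm (part b i y))
      \<and> L * norm (v - f y u) < \<kappa>' - \<kappa>"
    using eventually_conj[OF ev1 eventually_conj[OF ev2 ev3]] unfolding eventually_nhds_metric by blast
  define r where "r = min d e"
  have r: "0 < r" using d(1) e(1) by (simp add: r_def)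
  have lip: "L-lipschitz_on (cball x r) (Vp i)"
    by (rule lipschitz_on_subset[OF d(2)]) (auto simp: r_def)
  have deriv: "D v \<le> - \<kappa>" if y: "y \<in> ball x r" and D: "(Vp i has_derivative D) (at y)" for y D
  proof -
    have y': "dist y x < e" using y by (simp add: r_def dist_commute)
    interpret D: bounded_linear D using D by (rule has_derivative_bounded_linear)
    have "D (part b i (f y u)) \<le> - \<alpha> (norm (part b i y))"
      using \<alpha> has_derivative_block[OF D] e(2)[OF y'] unfolding decay_rate_def by (meson less_imp_le)
    then have "D (f y u) \<le> - \<kappa>'" using e(2)[OF y'] by (simp add: derivative_part[OF D])
    moreover have "\<bar>D (v - f y u)\<bar> \<le> L * norm (v - f y u)"
      by (rule lipschitz_derivative_bound[OF lipschitz_on_subset[OF lip ball_subset_cball] open_ball y D])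
    moreover have "L * norm (v - f y u) < \<kappa>' - \<kappa>" using e(2)[OF y'] by blast
    ultimately show ?thesis by (simp add: D.diff)
  qed
  \<comment> \<open>The summand 1 covers the case v = 0, and r / 2 keeps the segment inside the open
    ball.\<close>
  define \<delta> where "\<delta> = r / 2 / (1 + norm v)"
  have \<delta>: "0 < \<delta>" using r by (auto simp: \<delta>_def add_pos_nonneg intro!: divide_pos_pos)
  have seg: "x + t *\<^sub>R v \<in> ball x r" if t: "t \<in> {0..\<delta>}" for t
  proof -
    have "t * norm v \<le> \<delta> * (1 + norm v)" using t \<delta> by (intro mult_mono) auto
    also have "\<dots> = r / 2"
    proof -
      have "1 + norm v \<noteq> 0" using norm_ge_zero[of v] by linarith
      then show ?thesis by (rule nonzero_eq_divide_eq[THEN iffD1, OF _ \<delta>_def])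
    qed
    also have "\<dots> < r" using r by simp
    finally show ?thesis using t by (simp add: dist_norm)
  qed
  have "Vp i (x + t *\<^sub>R v) - Vp i x \<le> - \<kappa> * t" if t: "t \<in> {0..\<delta>}" for t
    using t by (intro increment_le_if_derivatives_le[OF lip _ _ deriv] seg) auto
  with \<delta> show ?thesis unfolding v_def by blast
qed

text \<open>Active indices decrease at the rate of \<open>Vp_decay\<close> times the slope
  \<open>c\<close>, and inactive ones stay below the decreasing level for short times. As the index
  set is finite, the maximum decreases too, and the right difference quotient suffices because
  \<open>D\<close> exists.\<close>

lemma Vmax_decay:
  assumes dom: "dominated (Vmax x) u" and x: "x \<noteq> 0" and D: "(Vmax has_derivative D) (at x)"
    and AB: "0 < A" "\<And>i. A < \<sigma> i (Vmax x)" "\<And>i. \<sigma> i (Vmax x) < B"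
    and c: "0 < c" "\<And>i p q. p \<in> {A..B} \<Longrightarrow> q \<in> {p..B} \<Longrightarrow> c * (q - p) \<le> Kinv (\<sigma> i) q - Kinv (\<sigma> i) p"
    and rate: "\<And>i. decay_rate i (\<alpha> i)"
    and \<kappa>: "0 \<le> \<kappa>"
    and m: "\<And>i. W i x = Vmax x \<Longrightarrow> \<kappa> < \<alpha> i (norm (part b i x))"
  shows "D (f x u) \<le> - (c * \<kappa>)"
proof -
  define v where "v = f x u"
  let ?r = "Vmax x"
  have line: "((\<lambda>t. g (x + t *\<^sub>R v)) \<longlongrightarrow> g x) (at_right 0)" if "continuous_on UNIV g" for g :: "real ^ 'k \<Rightarrow> real"
  proof -
    have "((\<lambda>t. x + t *\<^sub>R v) \<longlongrightarrow> x + 0 *\<^sub>R v) (at_right 0)" by (intro tendsto_intros)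
    then show ?thesis using continuous_on_tendsto_compose[OF that, of "\<lambda>t. x + t *\<^sub>R v" x] by simp
  qed
  have "\<forall>\<^sub>F t in at_right 0. W i (x + t *\<^sub>R v) \<le> ?r - c * \<kappa> * t" for i
  proof (cases "W i x = ?r")
    case True
    have Vr: "Vp i x = \<sigma> i ?r" using \<sigma>_W[of i x] True by simp
    have "0 < Vp i x" using Vr AB(1) AB(2)[of i] by simp
    then have "part b i x \<noteq> 0" by (simp add: Vp_pos_iff)
    then obtain \<delta> where \<delta>: "0 < \<delta>" "\<And>t. t \<in> {0..\<delta>} \<Longrightarrow> Vp i (x + t *\<^sub>R v) - Vp i x \<le> - \<kappa> * t"
      using Vp_decay[OF rate dom True _ m[OF True]] unfolding v_def by blast
    have "\<forall>\<^sub>F t in at_right 0. A < Vp i (x + t *\<^sub>R v) \<and> Vp i (x + t *\<^sub>R v) < B"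
      using order_tendstoD[OF line[OF cont_Vp[of i]]] AB(2,3)[of i] by (auto simp: Vr intro: eventually_conj)
    moreover have "\<forall>\<^sub>F t in at_right 0. 0 < t \<and> t < \<delta>"
      using \<delta>(1) eventually_at_right_real by (auto elim: eventually_mono)
    ultimately show ?thesis
    proof eventually_elim
      case (elim t)
      let ?q = "Vp i x" and ?p = "Vp i (x + t *\<^sub>R v)"
      have dec: "\<kappa> * t \<le> ?q - ?p" using \<delta>(2)[of t] elim by simp
      have "c * \<kappa> * t \<le> ?r - W i (x + t *\<^sub>R v)"
      proof -
        have "c * (\<kappa> * t) \<le> c * (?q - ?p)" using dec c(1) by (intro mult_left_mono) auto
        also have "\<dots> \<le> W i x - W i (x + t *\<^sub>R v)"
        proof (rule c(2))
          \<comment> \<open>Nonnegativity of \<kappa> orders the two values, as the slope bound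
            requires.\<close>
          have "0 \<le> \<kappa> * t" using \<kappa> elim by simp
          then show "?q \<in> {?p..B}" using dec AB(3)[of i] Vr by simp
        qed (use elim in simp)
        finally show ?thesis using True by (simp add: mult.assoc)
      qed
      then show ?case by simp
    qed
  next
    case False
    then have "W i x < ?r" using W_le_Vmax[of i x] by simp
    \<comment> \<open>The strict gap of an inactive index absorbs the term
      \<open>c * \<kappa> * t\<close> for small t.\<close>
    moreover have "((\<lambda>t. W i (x + t *\<^sub>R v) + c * \<kappa> * t) \<longlongrightarrow> W i x + c * \<kappa> * 0) (at_right 0)"
      by (intro tendsto_intros line cont_W)
    ultimately have "\<forall>\<^sub>F t in at_right 0. W i (x + t *\<^sub>R v) + c * \<kappa> * t < ?r"
      by (intro order_tendstoD(2)) auto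
    then show ?thesis by eventually_elim simp
  qed
  then have "\<forall>\<^sub>F t in at_right 0. \<forall>i. W i (x + t *\<^sub>R v) \<le> ?r - c * \<kappa> * t"
    by (rule eventually_all_finite)
  then have "\<forall>\<^sub>F t in at_right 0. Vmax (x + t *\<^sub>R v) \<le> ?r - c * \<kappa> * t"
    by (simp add: Vmax_le_iff)
  then have "\<forall>\<^sub>F t in at_right 0. (Vmax (x + t *\<^sub>R v) - ?r) / t \<le> - (c * \<kappa>)"
    using eventually_at_right_less[of 0] by eventually_elim (simp add: divide_le_eq)
  moreover have "((\<lambda>t. (Vmax (x + t *\<^sub>R v) - ?r) / t) \<longlongrightarrow> D v) (at_right 0)"
    using has_real_derivative_line[of Vmax D x 0 v] D
    by (simp add: DERIV_def filterlim_at_split)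
  ultimately show ?thesis unfolding v_def by (intro tendsto_upperbound) auto
qed

text \<open>On an annulus the levels \<open>\<sigma> i (Vmax x)\<close> stay in a compact interval
  of positive numbers, which makes the slope bound uniform. Only active blocks enter the decay, and
  these stay away from 0, so their rates have a positive minimum.\<close>

lemma Vmax_decay_annulus:
  assumes "0 < a" "a \<le> e"
  shows "\<exists>m>0. \<forall>x u D. norm x \<in> {a..e} \<longrightarrow> dominated (Vmax x) u \<longrightarrow> (Vmax has_derivative D) (at x) \<longrightarrow>
    D (f x u) \<le> - m"
proof -
  obtain \<psi>1 \<psi>2 where \<psi>: "class_Kinf \<psi>1" "class_Kinf \<psi>2"
    "\<And>x. \<psi>1 (norm x) \<le> Vmax x" "\<And>x. Vmax x \<le> \<psi>2 (norm x)"
    by (rule Vmax_bounds) blast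
  define r where "r = \<psi>1 a"
  have r: "0 < r" using class_K_pos[OF class_Kinf_imp_K[OF \<psi>(1)] assms(1)] by (simp add: r_def)
  have Vr: "r \<le> Vmax x" "Vmax x \<le> \<psi>2 e" if "norm x \<in> {a..e}" for x
    using that assms class_K_mono[OF class_Kinf_imp_K[OF \<psi>(1)], of a "norm x"]
      class_K_mono[OF class_Kinf_imp_K[OF \<psi>(2)], of "norm x" e] \<psi>(3,4)[of x]
    by (auto simp: r_def intro: order_trans)
  \<comment> \<open>Halving here and adding 1 in \<open>B\<close> place all levels strictly inside
    \<open>{A..B}\<close>; this leaves room to move along the segment.\<close>
  define A where "A = (MIN i. \<sigma> i r) / 2"
  define B where "B = (MAX i. \<sigma> i (\<psi>2 e)) + 1"
  have "0 < (MIN i. \<sigma> i r)" using r class_K_pos[OF K_\<sigma>] by simp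
  moreover have "(MIN i. \<sigma> i r) \<le> \<sigma> i r" for i by (rule Min_le) auto
  ultimately have A: "0 < A" "\<And>i. A < \<sigma> i r" unfolding A_def by (simp, smt (verit) field_sum_of_halves)
  have "\<sigma> i (\<psi>2 e) \<le> (MAX i. \<sigma> i (\<psi>2 e))" for i by (rule Max_ge) auto
  then have B: "\<sigma> i (\<psi>2 e) < B" for i unfolding B_def by (rule le_less_trans) simp
  have \<sigma>A: "A < \<sigma> i (Vmax x)" and \<sigma>B: "\<sigma> i (Vmax x) < B" if "norm x \<in> {a..e}" for x i
    using A(2)[of i] B[of i] class_K_mono[OF K_\<sigma>[of i], of r "Vmax x"]
      class_K_mono[OF K_\<sigma>[of i], of "Vmax x" "\<psi>2 e"] Vr[OF that] r by auto
  have "r \<le> \<psi>2 e"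
  proof -
    obtain x :: "real ^ 'k" where "norm x = a" using assms vector_choose_size[of a] by auto
    then show ?thesis using Vr[of x] assms by simp
  qed
  then have "A < B"
    using A(2) B class_K_mono[OF K_\<sigma>, of r "\<psi>2 e"] r by (meson less_imp_le less_le_trans order.strict_trans1)
  then obtain c where c: "0 < c" "\<And>i p q. p \<in> {A..B} \<Longrightarrow> q \<in> {p..B} \<Longrightarrow> c * (q - p) \<le> Kinv (\<sigma> i) q - Kinv (\<sigma> i) p"
    using Kinv_slope[OF A(1)] by metis
  obtain \<alpha> where \<alpha>: "\<And>i. decay_rate i (\<alpha> i)" using ex_decay_rate by metis
  have "\<exists>m>0. \<forall>i x. norm x \<in> {a..e} \<and> W i x = Vmax x \<longrightarrow> m \<le> \<alpha> i (norm (part b i x))"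
  proof (rule ex_uniform_lower_bound)
    fix i
    obtain p1 p2 where p: "class_Kinf p2" "\<And>x. Vp i x \<le> p2 (norm (part b i x))"
      using Vp_bounds[of i] by metis
    define \<rho> where "\<rho> = Kinv p2 (\<sigma> i r)"
    have \<rho>: "0 < \<rho>"
      using class_K_pos[OF class_Kinf_imp_K[OF class_Kinf_Kinv[OF p(1)]]] class_K_pos[OF K_\<sigma> r]
      by (simp add: \<rho>_def)
    \<comment> \<open>An active block has \<open>Vp i x\<close> at least
      \<open>\<sigma> i r\<close>, hence norm at least \<open>\<rho>\<close>. The maximum in the
      upper end keeps the interval nonempty even if block i is never active on the annulus.\<close>
    have inK: "norm (part b i x) \<in> {\<rho>..max e \<rho>}" if x: "norm x \<in> {a..e}" and act: "W i x = Vmax x" for x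
    proof -
      have "\<sigma> i r \<le> Vp i x"
        using class_K_mono[OF K_\<sigma>[of i], of r "Vmax x"] Vr[OF x] r \<sigma>_W[of i x] act by simp
      also have "\<dots> \<le> p2 (norm (part b i x))" by (rule p(2))
      finally have "\<rho> \<le> norm (part b i x)"
        unfolding \<rho>_def using Kinv_le_iff[OF p(1)] class_K_nonneg[OF K_\<sigma>] r by simp
      then show ?thesis using norm_part_le[of b i x] x by (auto simp: max_def)
    qed
    have pd: "pos_def_fun (\<alpha> i)" using \<alpha> by (simp add: decay_rate_def)
    have "continuous_on {\<rho>..max e \<rho>} (\<alpha> i)"
      by (rule continuous_on_subset[of "{0..}"]) (use pd \<rho> in \<open>auto simp: pos_def_fun_def\<close>)
    then obtain s where s: "s \<in> {\<rho>..max e \<rho>}" "\<And>t. t \<in> {\<rho>..max e \<rho>} \<Longrightarrow> \<alpha> i s \<le> \<alpha> i t"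
      using continuous_attains_inf[of "{\<rho>..max e \<rho>}" "\<alpha> i"] by auto
    have "0 < \<alpha> i s" using pd s(1) \<rho> by (auto simp: pos_def_fun_def less_le)
    then show "\<exists>m>0. \<forall>x. norm x \<in> {a..e} \<and> W i x = Vmax x \<longrightarrow> m \<le> \<alpha> i (norm (part b i x))"
      using s(2) inK by blast
  qed (meson order_trans)
  then obtain m where m: "0 < m" "\<And>i x. norm x \<in> {a..e} \<Longrightarrow> W i x = Vmax x \<Longrightarrow> m \<le> \<alpha> i (norm (part b i x))"
    by blast
  \<comment> \<open>Half of \<open>m\<close> is used because \<open>Vmax_decay\<close> requires a
    number strictly below the rates.\<close>
  have "D (f x u) \<le> - (c * (m / 2))"
    if x: "norm x \<in> {a..e}" and dom: "dominated (Vmax x) u" and D: "(Vmax has_derivative D) (at x)" for x u D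
  proof (rule Vmax_decay[OF dom _ D A(1) \<sigma>A[OF x] \<sigma>B[OF x] c \<alpha>])
    show "x \<noteq> 0" using x assms by auto
    show "m / 2 < \<alpha> i (norm (part b i x))" if "W i x = Vmax x" for i
      using m(2)[OF x that] m(1) by linarith
  qed (use m(1) in auto)
  moreover have "0 < c * (m / 2)" using c(1) m(1) by simp
  ultimately show ?thesis by blast
qed

lemma decreasing_with_gain_if_dominated:
  assumes "\<And>r u. 0 < r \<Longrightarrow> g (norm u) \<le> r \<Longrightarrow> dominated r u"
  shows "decreasing_with_gain f Vmax g"
proof -
  \<comment> \<open>\<open>P t y\<close> collects the observed decay values on the sphere of radius
    t. The annulus bounds are exactly the premise under which they have a positive definite
    minorant.\<close>
  define P where "P t y \<longleftrightarrow> (\<exists>x u D. norm x = t \<and> dominated (Vmax x) u \<and> (Vmax has_derivative D) (at x)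
      \<and> y = - D (f x u))" for t y
  obtain \<alpha> where \<alpha>: "pos_def_fun \<alpha>" "\<And>t y. 0 < t \<Longrightarrow> P t y \<Longrightarrow> \<alpha> t \<le> y"
  proof -
    have "\<exists>m>0. \<forall>t\<in>{a..e}. \<forall>y. P t y \<longrightarrow> m \<le> y" if ae: "0 < a" "a \<le> e" for a e
    proof -
      obtain m where "0 < m" "\<And>x u D. norm x \<in> {a..e} \<Longrightarrow> dominated (Vmax x) u \<Longrightarrow>
          (Vmax has_derivative D) (at x) \<Longrightarrow> D (f x u) \<le> - m"
        using Vmax_decay_annulus[OF ae] by blast
      then show ?thesis by (intro exI[of _ m]) (force simp: P_def)
    qed
    then show ?thesis using pos_def_minorant[of P] that by blast
  qed
  have "D (f x u) \<le> - \<alpha> (norm x)"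
    if D: "(Vmax has_derivative D) (at x)" and g: "g (norm u) \<le> Vmax x" for x u D
  proof (cases "x = 0")
    case False
    then have "P (norm x) (- D (f x u))" using assms[OF Vmax_pos[OF False] g] D by (auto simp: P_def)
    then show ?thesis using \<alpha>(2)[of "norm x"] False by force
  next
    case True
    \<comment> \<open>The origin is a minimum, so any derivative there is 0, which matches
      \<open>\<alpha> 0 = 0\<close>.\<close>
    have "Vmax 0 = 0"
      using Vmax_bounds by (metis Vmax_nonneg antisym class_Kinf_imp_K class_K_def norm_zero)
    then have "D = (\<lambda>h. 0)"
      using differential_zero_maxmin[of x UNIV Vmax D] D Vmax_nonneg True by auto
    moreover have "\<alpha> 0 = 0" using \<alpha>(1) by (simp add: pos_def_fun_def)
    ultimately show ?thesis using True by simp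
  qed
  then show ?thesis unfolding decreasing_with_gain_def using \<alpha>(1) by blast
qed

text \<open>A block of x may vanish although x does not, and \<open>W i\<close> need not be
  Lipschitz there. Such an index is inactive and remains so nearby; hence only indices with
  Lipschitz \<open>W i\<close> determine the maximum.\<close>

lemma locally_lipschitz_Vmax: "locally_lipschitz_on (UNIV - {0}) Vmax"
  unfolding locally_lipschitz_on_def
proof (rule local_lipschitzI)
  fix t :: real and x :: "real ^ 'k" assume "x \<in> UNIV - {0}"
  then have pos: "0 < Vmax x" using Vmax_pos by simp
  have "\<exists>d>0. \<forall>i. (\<exists>L. L-lipschitz_on (cball x d) (W i)) \<or> (\<forall>y\<in>cball x d. W i y < Vmax y)"
  proof (rule ex_uniform_lower_bound)
    fix i
    show "\<exists>d>0. (\<exists>L. L-lipschitz_on (cball x d) (W i)) \<or> (\<forall>y\<in>cball x d. W i y < Vmax y)"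
    proof (cases "W i x = Vmax x")
      case True
      have "Vp i x \<noteq> 0" using pos class_K_pos[OF K_\<sigma> pos, of i] True \<sigma>_W[of i x] by auto
      then have "part b i x \<noteq> 0" using Vp_pos_iff[of i x] Vp_nonneg[of i x] by auto
      then show ?thesis using W_local_lipschitz by metis
    next
      case False
      then have "x \<in> {y. W i y < Vmax y}" using W_le_Vmax[of i x] by simp
      then show ?thesis
        using open_Collect_less[OF cont_W cont_Vmax, of i] unfolding open_contains_cball by blast
    qed
  next
    show "(\<exists>L. L-lipschitz_on (cball x m') (W i)) \<or> (\<forall>y\<in>cball x m'. W i y < Vmax y)"
      if "(\<exists>L. L-lipschitz_on (cball x m) (W i)) \<or> (\<forall>y\<in>cball x m. W i y < Vmax y)" "m' \<le> m" for i m m'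
      using that lipschitz_on_subset[OF _ subset_cball[OF that(2)]] subset_cball[OF that(2)] by blast
  qed
  then obtain d where d: "0 < d"
    "\<And>i. (\<exists>L. L-lipschitz_on (cball x d) (W i)) \<or> (\<forall>y\<in>cball x d. W i y < Vmax y)" by blast
  then obtain L where L: "\<And>i. (L i)-lipschitz_on (cball x d) (W i) \<or> (\<forall>y\<in>cball x d. W i y < Vmax y)"
    by metis
  \<comment> \<open>The constants of non-Lipschitz indices are arbitrary reals; absolute values make
    the sum an upper bound for the relevant ones.\<close>
  define M where "M = (\<Sum>i\<in>UNIV. \<bar>L i\<bar>)"
  have le: "Vmax y - Vmax z \<le> M * dist y z" if yz: "y \<in> cball x d" "z \<in> cball x d" for y z
  proof -
    obtain i where i: "W i y = Vmax y" using Vmax_attained by blast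
    then have Li: "(L i)-lipschitz_on (cball x d) (W i)" using L[of i] yz(1) by force
    have "Vmax y - Vmax z \<le> W i y - W i z" using i W_le_Vmax[of i z] by simp
    also have "\<dots> \<le> dist (W i y) (W i z)" by (simp add: dist_real_def)
    also have "\<dots> \<le> L i * dist y z" by (rule lipschitz_onD[OF Li yz])
    also have "\<dots> \<le> M * dist y z"
    proof (rule mult_right_mono)
      have "\<bar>L i\<bar> \<le> M" unfolding M_def by (rule member_le_sum) auto
      then show "L i \<le> M" by simp
    qed simp
    finally show ?thesis .
  qed
  have "M-lipschitz_on (cball x d) Vmax"
  proof (rule lipschitz_onI)
    show "0 \<le> M" unfolding M_def by (rule sum_nonneg) simp
    show "dist (Vmax y) (Vmax z) \<le> M * dist y z" if "y \<in> cball x d" "z \<in> cball x d" for y z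
      using le[OF that] le[OF that(2,1)] by (simp add: dist_real_def abs_le_iff dist_commute)
  qed
  then have "M-lipschitz_on (cball x d \<inter> (UNIV - {0})) Vmax" by (rule lipschitz_on_subset) auto
  with d(1) show "\<exists>u>0. \<exists>L. \<forall>t\<in>cball t u \<inter> {0}. L-lipschitz_on (cball x u \<inter> (UNIV - {0})) Vmax" by blast
qed

lemma lyapunov_candidate_Vmax: "lyapunov_candidate_on UNIV Vmax"
  unfolding lyapunov_candidate_on_def
  using cont_Vmax locally_lipschitz_Vmax Vmax_bounds by (metis UNIV_I)

text \<open>The natural threshold \<open>g\<close> need not be of class K, for example when all
  input gains vanish. Enlarging it to \<open>k\<close> only strengthens the premise of the decay
  implication.\<close>

lemma iss_lyapunov_Vmax:
  assumes "\<And>r u. 0 < r \<Longrightarrow> g (norm u) \<le> r \<Longrightarrow> dominated r u"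
    and "class_K k" "\<And>v. 0 \<le> v \<Longrightarrow> g v \<le> k v"
  shows "iss_lyapunov f Vmax"
proof -
  have "decreasing_with_gain f Vmax k"
    using assms(1,3) by (intro decreasing_with_gain_if_dominated) (meson norm_ge_zero order_trans)
  then show ?thesis using lyapunov_candidate_Vmax assms(2) by (auto simp: iss_lyapunov_def)
qed

text \<open>The parameter \<open>g\<close> covers both premises on \<open>\<phi>\<close>: it is
  \<open>\<gamma>u\<close> in one and the identity in the other.\<close>

lemma dominated_if_vless:
  assumes less: "vless (gain_op_bar \<mu> \<gamma> g (\<chi> i. \<sigma> i r) (\<phi> r)) (\<chi> i. \<sigma> i r)" and r: "0 \<le> r"
    and g: "\<And>i. \<gamma>u i (norm u) \<le> g i (\<phi> r)"
  shows "dominated r u"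
  unfolding dominated_def
proof
  fix i
  have "\<mu> i (vjoin (\<chi> j. \<gamma> i j (\<sigma> j r)) (\<gamma>u i (norm u))) \<le> \<mu> i (vjoin (\<chi> j. \<gamma> i j (\<sigma> j r)) (g i (\<phi> r)))"
    using g[of i] input_gain_nonneg[of "norm u" i] r
    by (intro MAF_mono[OF maf[rule_format]])
      (auto simp: vjoin_def orthant_def gain_nonneg class_K_nonneg[OF K_\<sigma>] split: option.split)
  also have "\<dots> < \<sigma> i r" using less by (simp add: vless_def gain_op_bar_def)
  finally show "\<mu> i (vjoin (\<chi> j. \<gamma> i j (\<sigma> j r)) (\<gamma>u i (norm u))) < \<sigma> i r" .
qed

text \<open>The sum majorises the maximum of its nonnegative terms, and the added v gives strict
  growth even if all input gains are zero.\<close>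

lemma class_K_input_gain_bound:
  assumes \<phi>: "class_Kinf \<phi>"
  shows "class_K (\<lambda>v. (\<Sum>i\<in>UNIV. Kinv \<phi> (\<gamma>u i v)) + v)"
proof -
  note k = class_Kinf_imp_K[OF class_Kinf_Kinv[OF \<phi>]]
  have cont: "continuous_on {0..} (\<lambda>v. Kinv \<phi> (\<gamma>u i v))" for i
  proof (rule continuous_on_compose2[OF class_K_cont[OF k]])
    show "continuous_on {0..} (\<gamma>u i)"
    proof (cases "zero_gain (\<gamma>u i)")
      case True
      then show ?thesis
        by (intro continuous_on_eq[OF continuous_on_const[of _ 0]]) (auto simp: zero_gain_def)
    qed (use gains_input class_K_cont in blast)
  qed (auto intro: input_gain_nonneg)
  have "\<gamma>u i 0 = 0" for i using gains_input by (auto simp: class_K_def zero_gain_def)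
  then have "Kinv \<phi> (\<gamma>u i 0) = 0" for i using k by (simp add: class_K_def)
  moreover have "(\<Sum>i\<in>UNIV. Kinv \<phi> (\<gamma>u i v)) + v < (\<Sum>i\<in>UNIV. Kinv \<phi> (\<gamma>u i w)) + w"
    if "0 \<le> v" "v < w" for v w
    using that by (intro add_le_less_mono sum_mono class_K_mono[OF k] input_gain_nonneg input_gain_mono) auto
  ultimately show ?thesis
    using cont by (auto simp: class_K_def intro!: strict_mono_onI continuous_intros)
qed

end

theorem theorem5p3:
  fixes b :: "'k::finite \<Rightarrow> 'n::finite"
    and f :: "real ^ 'k \<Rightarrow> real ^ 'm::finite \<Rightarrow> real ^ 'k"
    and V :: "'n \<Rightarrow> real ^ 'k \<Rightarrow> real"
    and \<mu> :: "'n \<Rightarrow> real ^ 'n option \<Rightarrow> real"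
    and \<gamma> :: "'n \<Rightarrow> 'n \<Rightarrow> real \<Rightarrow> real"
    and \<gamma>u :: "'n \<Rightarrow> real \<Rightarrow> real"
    and \<sigma> :: "'n \<Rightarrow> real \<Rightarrow> real"
    and \<phi> :: "real \<Rightarrow> real"
  assumes continuous: "\<forall>u. continuous_on UNIV (\<lambda>x. f x u)"
    and wellposed: "\<forall>i. subsystem_wellposed b f i"
    and candidates: "\<forall>i. lyapunov_candidate_on (block b i) (V i)"
    and maf: "\<forall>i. MAF (\<mu> i)"
    and gains: "\<forall>i j. class_Kinf (\<gamma> i j) \<or> zero_gain (\<gamma> i j)"
    and gains_diag: "\<forall>i. zero_gain (\<gamma> i i)"
    and gains_input: "\<forall>i. class_K (\<gamma>u i) \<or> zero_gain (\<gamma>u i)"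
    and compatible: "compatible \<mu> \<gamma>"
    and lyapunov: "\<forall>i. subsystem_iss_lyapunov b f V \<mu> \<gamma> \<gamma>u i"
    and path: "Omega_path (gain_op \<mu> \<gamma> \<gamma>u) \<sigma>"
    and phi: "class_Kinf \<phi>"
  shows "((\<forall>r>0. vless (gain_op_bar \<mu> \<gamma> \<gamma>u (\<chi> i. \<sigma> i r) (\<phi> r)) (\<chi> i. \<sigma> i r)) \<longrightarrow>
            iss_lyapunov f (overall_V b \<sigma> V) \<and>
            decreasing_with_gain f (overall_V b \<sigma> V) (\<lambda>v. Kinv \<phi> v))
       \<and> ((\<forall>r>0. vless (gain_op_bar \<mu> \<gamma> (\<lambda>i v. v) (\<chi> i. \<sigma> i r) (\<phi> r)) (\<chi> i. \<sigma> i r)) \<longrightarrow>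
            iss_lyapunov f (overall_V b \<sigma> V) \<and>
            decreasing_with_gain f (overall_V b \<sigma> V) (\<lambda>v. MAX i. Kinv \<phi> (\<gamma>u i v)))"
proof -
  interpret interconnection b f V \<mu> \<gamma> \<gamma>u \<sigma>
    using continuous candidates maf gains gains_input lyapunov path by unfold_locales
  note kinv = class_Kinf_imp_K[OF class_Kinf_Kinv[OF phi]]
  show ?thesis
  proof (intro conjI impI)
    assume less: "\<forall>r>0. vless (gain_op_bar \<mu> \<gamma> \<gamma>u (\<chi> i. \<sigma> i r) (\<phi> r)) (\<chi> i. \<sigma> i r)"
    \<comment> \<open>The threshold says \<open>norm u\<close> is at most \<open>\<phi> r\<close>;
      applying the monotone \<open>\<gamma>u i\<close> gives the comparison needed.\<close>
    have dom: "dominated r u" if "0 < r" "Kinv \<phi> (norm u) \<le> r" for r u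
      using that less phi
      by (intro dominated_if_vless[where g = \<gamma>u and \<phi> = \<phi>] input_gain_mono) (auto simp: Kinv_le_iff)
    then show "decreasing_with_gain f Vmax (\<lambda>v. Kinv \<phi> v)"
      by (intro decreasing_with_gain_if_dominated) auto
    show "iss_lyapunov f Vmax"
      by (rule iss_lyapunov_Vmax[where g = "Kinv \<phi>" and k = "Kinv \<phi>"]) (use dom kinv in auto)
  next
    assume less: "\<forall>r>0. vless (gain_op_bar \<mu> \<gamma> (\<lambda>i v. v) (\<chi> i. \<sigma> i r) (\<phi> r)) (\<chi> i. \<sigma> i r)"
    \<comment> \<open>Here the threshold bounds \<open>\<gamma>u i (norm u)\<close> itself by
      \<open>\<phi> r\<close>, for every i.\<close>
    have dom: "dominated r u" if r: "0 < r" and "(MAX i. Kinv \<phi> (\<gamma>u i (norm u))) \<le> r" for r u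
    proof (rule dominated_if_vless[where g = "\<lambda>i v. v" and \<phi> = \<phi>])
      have "Kinv \<phi> (\<gamma>u i (norm u)) \<le> r" for i
        using that(2) by (subst (asm) Max_le_iff) auto
      then show "\<gamma>u i (norm u) \<le> \<phi> r" for i
        using phi r input_gain_nonneg by (simp add: Kinv_le_iff)
    qed (use r less in auto)
    then show "decreasing_with_gain f Vmax (\<lambda>v. MAX i. Kinv \<phi> (\<gamma>u i v))"
      by (intro decreasing_with_gain_if_dominated) auto
    show "iss_lyapunov f Vmax"
    proof (rule iss_lyapunov_Vmax[OF dom class_K_input_gain_bound[OF phi]])
      fix v :: real assume v: "0 \<le> v"
      have nn: "0 \<le> Kinv \<phi> (\<gamma>u i v)" for i by (intro Kinv_nonneg phi input_gain_nonneg v)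
      have "Kinv \<phi> (\<gamma>u i v) \<le> (\<Sum>i\<in>UNIV. Kinv \<phi> (\<gamma>u i v))" for i
        by (rule member_le_sum) (use nn in auto)
      then have "(MAX i. Kinv \<phi> (\<gamma>u i v)) \<le> (\<Sum>i\<in>UNIV. Kinv \<phi> (\<gamma>u i v))"
        by (subst Max_le_iff) auto
      then show "(MAX i. Kinv \<phi> (\<gamma>u i v)) \<le> (\<Sum>i\<in>UNIV. Kinv \<phi> (\<gamma>u i v)) + v" using v by linarith
    qed
  qed
qed

end
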